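(* Let $d \geq 2$ be an integer and let $E \subset M_d^{0}(\mathbb{Z})$ satisfy $\overline{d}(E) > 0$. Then there exists an integer $k \geq 1$ such that for every $A \in k \cdot M_d^0(\mathbb{Z})$ there exists $g \in \operatorname{SL}_d(\mathbb{Z})$ with \[ \overline{d}\big(E \cap (E - gAg^{-1})\big) > 0, \] where $E - B = \{x - B : x \in E\}$ for a matrix $B$.
   Context: $M_d^0(\mathbb{Z})$ denotes the additive group of $d\times d$ integer matrices with trace zero, and $k\cdot M_d^0(\mathbb{Z})$ the set of such matrices all of whose entries are divisible by $k$. For $n \ge 1$ let $F_n = \{A=(a_{ij}) \in M_d^0(\mathbb{Z}) : |a_{ij}| \le n \text{ for all } (i,j) \neq (d,d)\}$. For $E \subset M_d^0(\mathbb{Z})$, its upper asymptotic density is $\overline{d}(E) = \limsup_{n\to\infty} |E \cap F_n|/|F_n|$. *)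

theory Defs
  imports "Jordan_Normal_Form.Determinant" "HOL-Library.Liminf_Limsup" "HOL-Library.Extended_Real"
begin

text \<open>Matrices are Jordan_Normal_Form matrices; rows/columns are indexed 0..d-1,
  so the paper's entry (d,d) is the entry (d-1,d-1).\<close>

definition mtrace :: "int mat \<Rightarrow> int" where
  "mtrace A = (\<Sum>i<dim_row A. A $$ (i, i))"

definition M0 :: "nat \<Rightarrow> int mat set" where
  "M0 d = {A \<in> carrier_mat d d. mtrace A = 0}"

definition kM0 :: "int \<Rightarrow> nat \<Rightarrow> int mat set" where
  "kM0 k d = {A \<in> M0 d. \<forall>i<d. \<forall>j<d. k dvd A $$ (i, j)}"

definition Fbox :: "nat \<Rightarrow> nat \<Rightarrow> int mat set" where
  "Fbox d n = {A \<in> M0 d. \<forall>i<d. \<forall>j<d. (i, j) \<noteq> (d - 1, d - 1) \<longrightarrow> \<bar>A $$ (i, j)\<bar> \<le> int n}"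

definition upper_density :: "nat \<Rightarrow> int mat set \<Rightarrow> ereal" where
  "upper_density d E =
     limsup (\<lambda>n. ereal (real (card (E \<inter> Fbox d n)) / real (card (Fbox d n))))"

definition SL :: "nat \<Rightarrow> int mat set" where
  "SL d = {g \<in> carrier_mat d d. det g = 1}"

definition set_minus_mat :: "int mat set \<Rightarrow> int mat \<Rightarrow> int mat set" where
  "set_minus_mat E B = (\<lambda>x. x - B) ` E"

end

theory Submission
  imports Defs
    "HOL-Analysis.Convex"
    "HOL-Analysis.Function_Topology"
    "HOL-Computational_Algebra.Polynomial"
    "HOL-Library.FuncSet"
    "HOL-Library.Function_Algebras"
    "HOL-Real_Asymp.Real_Asymp"
    "Jordan_Normal_Form.Column_Operations"
begin

text \<open>
  A mean along the boxes \<open>F\<^sub>n\<close> turns \<open>B \<mapsto> d(E \<inter> (E - B))\<close> into a correlation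
  \<open>\<langle>f, T\<^sub>B f\<rangle>\<close> of an orthogonal action of the trace zero matrices, \<open>f\<close> being the indicator of \<open>E\<close>.
  For a subgroup \<open>S\<close> let \<open>m(S)\<close> be the infimum of \<open>|u|\<^sup>2\<close> over the convex hull of the \<open>S\<close>-orbit
  of \<open>f\<close>; almost minimal vectors are almost unique and almost \<open>S\<close>-invariant (they stand in for the
  projection of \<open>f\<close> to the \<open>S\<close>-invariant vectors, so no completeness is needed). The bounded quantity
  \<open>m(k M)\<close> is monotone along divisibility of \<open>k\<close>, so \<open>k\<close> can be chosen such that passing to multiples
  of \<open>k\<close> gains next to nothing; this choice does not involve \<open>A\<close>.

  For \<open>A \<noteq> 0\<close> in \<open>k M\<close> there is a polynomial curve \<open>P(t) = g(t) A g(t)\<^sup>-\<^sup>1\<close>, with \<open>g(t)\<close> a product of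
  elementary matrices with entries powers of \<open>t\<close>, whose nonconstant coefficients span the trace
  zero matrices over the rationals. By van der Corput's inequality the averages of \<open>T\<^bsub>P(t)\<^esub> f\<close> agree
  up to a small error with those of \<open>T\<^bsub>P(t)\<^esub> u\<close>, where \<open>u\<close> is almost invariant under \<open>l M\<close> for some
  multiple \<open>l\<close> of \<open>k\<close> depending on \<open>A\<close>. By the choice of \<open>k\<close> this \<open>u\<close> is close to the almost
  \<open>k M\<close>-invariant vector, which \<open>T\<^bsub>P(t)\<^esub>\<close> almost fixes as \<open>P(t) \<in> k M\<close>; hence the average
  correlation is close to \<open>m(k M) > 0\<close>.
\<close>

section \<open>Averages in semi-inner product spaces\<close>

definition avg :: "nat \<Rightarrow> (nat \<Rightarrow> 'v::real_vector) \<Rightarrow> 'v" where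
  "avg n x = (1 / real n) *\<^sub>R (\<Sum>t<n. x t)"

lemma avg_add: "avg n (\<lambda>t. x t + y t) = avg n x + avg n y"
  by (simp add: avg_def sum.distrib scaleR_right_distrib)

lemma avg_diff: "avg n (\<lambda>t. x t - y t) = avg n x - avg n y"
  by (simp add: avg_def sum_subtractf scaleR_right_diff_distrib)

lemma avg_const: "n > 0 \<Longrightarrow> avg n (\<lambda>t. c) = c"
  by (simp add: avg_def sum_constant_scaleR)

lemma avg_sum: "avg n (\<lambda>t. \<Sum>i\<in>I. x i t) = (\<Sum>i\<in>I. avg n (x i))"
  unfolding avg_def by (subst sum.swap) (simp add: scaleR_sum_right)

lemma avg_scale: "avg n (\<lambda>t. c *\<^sub>R x t) = c *\<^sub>R avg n x"
  by (simp add: avg_def scaleR_sum_right mult.commute)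

lemma sum_residue_classes:
  fixes x :: "nat \<Rightarrow> 'v::comm_monoid_add"
  assumes "l > 0"
  shows "(\<Sum>t<l * n. x t) = (\<Sum>r<l. \<Sum>t<n. x (l * t + r))"
proof (induction n)
  case (Suc n)
  have "(\<Sum>t<l * Suc n. x t) = (\<Sum>t<l * n. x t) + (\<Sum>t=l*n..<l*n+l. x t)"
    by (metis add.commute le_add1 lessThan_atLeast0 mult_Suc_right sum.atLeastLessThan_concat zero_le)
  also have "(\<Sum>t=l*n..<l*n+l. x t) = (\<Sum>r<l. x (l * n + r))"
    using sum.shift_bounds_nat_ivl[of x 0 "l*n" l] by (simp add: lessThan_atLeast0 add.commute)
  finally show ?case by (simp add: Suc sum.distrib)
qed simp

lemma avg_residue_classes:
  assumes "l > 0"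
  shows "avg (l * n) x = avg l (\<lambda>r. avg n (\<lambda>t. x (l * t + r)))"
  by (simp add: avg_def sum_residue_classes[OF assms] scaleR_sum_right)

lemma avg_in_convex:
  assumes "convex S" "n > 0" "\<And>t. t < n \<Longrightarrow> x t \<in> S"
  shows "avg n x \<in> S"
  unfolding avg_def scaleR_sum_right
  using assms by (intro convex_sum) auto

section \<open>Possibly degenerate inner products, their seminorm, and averages\<close>

locale semi_inner =
  fixes ip :: "'v::real_vector \<Rightarrow> 'v \<Rightarrow> real"
  assumes ip_commute: "ip u v = ip v u"
    and ip_add_left: "ip (u + v) w = ip u w + ip v w"
    and ip_scale_left: "ip (c *\<^sub>R u) v = c * ip u v"
    and ip_nonneg: "0 \<le> ip u u"
begin

lemma ip_add_right: "ip u (v + w) = ip u v + ip u w"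
  by (metis ip_commute ip_add_left)

lemma ip_scale_right: "ip u (c *\<^sub>R v) = c * ip u v"
  by (metis ip_commute ip_scale_left)

lemma ip_zero_left [simp]: "ip 0 u = 0"
  using ip_scale_left[of 0 0 u] by simp

lemma ip_zero_right [simp]: "ip u 0 = 0"
  by (metis ip_commute ip_zero_left)

lemma ip_minus_left: "ip (- u) v = - ip u v"
  using ip_scale_left[of "-1" u v] by simp

lemma ip_diff_left: "ip (u - v) w = ip u w - ip v w"
  using ip_add_left[of u "- v" w] by (simp add: ip_minus_left)

lemma ip_diff_right: "ip u (v - w) = ip u v - ip u w"
  by (metis ip_commute ip_diff_left)

lemma ip_sum_right: "ip u (\<Sum>i\<in>I. x i) = (\<Sum>i\<in>I. ip u (x i))"
  by (induction I rule: infinite_finite_induct) (auto simp: ip_add_right)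

lemma ip_sum_left: "ip (\<Sum>i\<in>I. x i) u = (\<Sum>i\<in>I. ip (x i) u)"
  by (induction I rule: infinite_finite_induct) (auto simp: ip_add_left)

lemma ip_avg_right: "ip u (avg n x) = avg n (\<lambda>t. ip u (x t))"
  by (simp add: avg_def ip_scale_right ip_sum_right)

lemma ip_cauchy_schwarz: "(ip u v)\<^sup>2 \<le> ip u u * ip v v"
proof -
  have q: "0 \<le> ip u u + 2 * t * ip u v + t\<^sup>2 * ip v v" for t
    using ip_nonneg[of "u + t *\<^sub>R v"]
    by (simp add: ip_add_left ip_add_right ip_scale_left ip_scale_right ip_commute[of v u]
        power2_eq_square algebra_simps)
  show ?thesis
  proof (cases "ip v v = 0")
    case True
    have "ip u v = 0"
    proof (rule ccontr)
      assume "ip u v \<noteq> 0"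
      \<comment> \<open>With \<open>ip v v = 0\<close> the quadratic in \<open>t\<close> is affine,
        and this \<open>t\<close> gives it the value -1.\<close>
      then show False
        using q[of "- (ip u u + 1) / (2 * ip u v)"] True by (simp add: field_simps)
    qed
    then show ?thesis using True by simp
  next
    case False
    then have "ip v v > 0" using ip_nonneg[of v] by simp
    then show ?thesis
      using q[of "- ip u v / ip v v"] by (simp add: field_simps power2_eq_square)
  qed
qed

text \<open>In general only a seminorm: the form obtained later from a limit of means may vanish on
  nonzero functions.\<close>

definition nrm :: "'v \<Rightarrow> real" where "nrm u = sqrt (ip u u)"

lemma nrm_nonneg [simp]: "0 \<le> nrm u"
  by (simp add: nrm_def ip_nonneg)

lemma nrm_sq: "(nrm u)\<^sup>2 = ip u u"
  by (simp add: nrm_def ip_nonneg)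

lemma abs_ip_le: "\<bar>ip u v\<bar> \<le> nrm u * nrm v"
  using real_sqrt_le_mono[OF ip_cauchy_schwarz[of u v]] by (simp add: nrm_def real_sqrt_mult)

lemma nrm_zero [simp]: "nrm 0 = 0"
  by (simp add: nrm_def)

lemma nrm_add: "nrm (u + v) \<le> nrm u + nrm v"
proof (rule power2_le_imp_le)
  have "(nrm (u + v))\<^sup>2 = (nrm u)\<^sup>2 + 2 * ip u v + (nrm v)\<^sup>2"
    by (simp add: nrm_sq ip_add_left ip_add_right ip_commute[of v u])
  also have "\<dots> \<le> (nrm u + nrm v)\<^sup>2"
    using abs_ip_le[of u v] by (simp add: power2_sum)
  finally show "(nrm (u + v))\<^sup>2 \<le> (nrm u + nrm v)\<^sup>2" .
qed simp

lemma nrm_scale: "nrm (c *\<^sub>R u) = \<bar>c\<bar> * nrm u"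
  by (simp add: nrm_def ip_scale_left ip_scale_right real_sqrt_mult flip: mult.assoc power2_eq_square)

lemma nrm_minus: "nrm (- u) = nrm u"
  using nrm_scale[of "-1" u] by simp

lemma nrm_diff: "nrm (u - v) \<le> nrm u + nrm v"
  using nrm_add[of u "- v"] by (simp add: nrm_minus)

lemma nrm_diff_triangle: "nrm (u - w) \<le> nrm (u - v) + nrm (v - w)"
  using nrm_add[of "u - v" "v - w"] by simp

lemma nrm_sum: "nrm (\<Sum>i\<in>I. x i) \<le> (\<Sum>i\<in>I. nrm (x i))"
proof (induction I rule: infinite_finite_induct)
  case (insert i I)
  then show ?case using nrm_add[of "x i" "sum x I"] by auto
qed auto

lemma nrm_avg_le_avg: "nrm (avg n x) \<le> avg n (\<lambda>t. nrm (x t))"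
  using nrm_sum[of x "{..<n}"] by (simp add: avg_def nrm_scale divide_right_mono)

lemma nrm_avg_le:
  assumes "K \<ge> 0" "\<And>t. t < n \<Longrightarrow> nrm (x t) \<le> K"
  shows "nrm (avg n x) \<le> K"
proof (cases "n = 0")
  case False
  have "(\<Sum>t<n. nrm (x t)) \<le> real n * K"
    using sum_bounded_above[of "{..<n}" "\<lambda>t. nrm (x t)" K] assms by simp
  then have "avg n (\<lambda>t. nrm (x t)) \<le> K"
    using False by (simp add: avg_def field_simps)
  then show ?thesis using nrm_avg_le_avg[of n x] by simp
qed (use assms in \<open>simp add: avg_def\<close>)

text \<open>Jensen's inequality as nonnegativity of a variance: the mean of the squared distances to
  \<open>avg n x\<close> expands to right side minus left side.\<close>

lemma ip_avg_avg_le: "ip (avg n x) (avg n x) \<le> avg n (\<lambda>t. ip (x t) (x t))"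
proof (cases "n = 0")
  case False
  let ?a = "avg n x"
  have pos: "0 \<le> avg n (\<lambda>t. ip (x t - ?a) (x t - ?a))"
    by (simp add: avg_def ip_nonneg sum_nonneg)
  have "ip (x t - ?a) (x t - ?a) = (ip (x t) (x t) - 2 *\<^sub>R ip ?a (x t)) + ip ?a ?a" for t
    using ip_commute[of "x t" ?a] by (simp add: ip_diff_left ip_diff_right)
  then have "avg n (\<lambda>t. ip (x t - ?a) (x t - ?a)) =
      avg n (\<lambda>t. (ip (x t) (x t) - 2 *\<^sub>R ip ?a (x t)) + ip ?a ?a)"
    by presburger
  also have "\<dots> = avg n (\<lambda>t. ip (x t) (x t)) - 2 * ip ?a ?a + ip ?a ?a"
    using False ip_avg_right[of ?a n x] avg_scale[of n 2 "\<lambda>t. ip ?a (x t)"]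
    by (simp add: avg_add avg_diff avg_const)
  finally show ?thesis using pos by simp
qed (simp add: avg_def)

text \<open>The two sums share all but \<open>s\<close> terms at each end, and each remaining term
  has norm at most \<open>K\<close>.\<close>

lemma nrm_shift_avg:
  assumes "K \<ge> 0" "\<And>t. nrm (x t) \<le> K"
  shows "nrm (avg n (\<lambda>t. x (t + s)) - avg n x) \<le> 2 * real s * K / real n"
proof -
  have "(\<Sum>t<n. x (t + s)) - (\<Sum>t<n. x t) = (\<Sum>t<s. x (t + n)) - (\<Sum>t<s. x t)"
  proof -
    have "(\<Sum>t<n + s. x t) = (\<Sum>t<s. x t) + (\<Sum>t<n. x (t + s))" for n s
      by (induction n) (auto simp: add.assoc)
    from this[of n s] this[of s n] show ?thesis by (simp add: algebra_simps)
  qed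
  also have "nrm \<dots> \<le> nrm (\<Sum>t<s. x (t + n)) + nrm (\<Sum>t<s. x t)"
    by (rule nrm_diff)
  also have "\<dots> \<le> (\<Sum>t<s. nrm (x (t + n))) + (\<Sum>t<s. nrm (x t))"
    by (intro add_mono nrm_sum)
  also have "\<dots> \<le> real s * K + real s * K"
    using sum_bounded_above[of "{..<s}" "\<lambda>t. nrm (x (t+n))" K]
      sum_bounded_above[of "{..<s}" "\<lambda>t. nrm (x t)" K] assms by (intro add_mono) auto
  finally have "nrm ((\<Sum>t<n. x (t + s)) - (\<Sum>t<n. x t)) \<le> 2 * real s * K" by (simp add: mult.assoc mult.commute)
  moreover have "avg n (\<lambda>t. x (t + s)) - avg n x = (1 / real n) *\<^sub>R ((\<Sum>t<n. x (t + s)) - (\<Sum>t<n. x t))"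
    by (simp add: avg_def scaleR_right_diff_distrib)
  ultimately show ?thesis
    by (simp add: nrm_scale divide_right_mono)
qed

lemma nrm_tendsto_shift_avg:
  assumes "K \<ge> 0" "\<And>t. nrm (x t) \<le> K" "e > 0"
  shows "\<forall>\<^sub>F n in sequentially. nrm (avg n (\<lambda>t. x (t + s)) - avg n x) \<le> e"
proof -
  have "(\<lambda>n. 2 * real s * K / real n) \<longlonglongrightarrow> 0"
    by (rule lim_const_over_n)
  then have "\<forall>\<^sub>F n in sequentially. 2 * real s * K / real n < e"
    using assms(3) by (rule order_tendstoD)
  then show ?thesis
    by eventually_elim (use nrm_shift_avg[OF assms(1,2)] in \<open>fastforce intro: order_trans less_imp_le\<close>)
qed

text \<open>Up to \<open>e\<close>, the sequence may be replaced by its means over \<open>S\<close>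
  consecutive shifts. Jensen bounds the squared norm of their average by the mean of all
  \<open>S^2\<close> shifted correlations: the diagonal ones contribute \<open>K^2 / S\<close>, the
  others at most \<open>c\<close>.\<close>

lemma van_der_corput:
  assumes "\<And>t. nrm (x t) \<le> K" "K \<ge> 0" "e > 0" "S > 0"
    and "\<And>s s'. s < S \<Longrightarrow> s' < S \<Longrightarrow> s \<noteq> s' \<Longrightarrow>
      \<forall>\<^sub>F n in sequentially. avg n (\<lambda>t. ip (x (t + s)) (x (t + s'))) \<le> c"
    and "c \<ge> 0"
  shows "\<forall>\<^sub>F n in sequentially. nrm (avg n x) \<le> e + sqrt (K\<^sup>2 / S + c)"
proof -
  have "\<forall>\<^sub>F n in sequentially. \<forall>s\<in>{..<S}. nrm (avg n (\<lambda>t. x (t + s)) - avg n x) \<le> e"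
    using assms by (intro eventually_ball_finite) (auto intro!: nrm_tendsto_shift_avg[where K=K])
  moreover have "\<forall>\<^sub>F n in sequentially. \<forall>p\<in>{..<S}\<times>{..<S}. fst p \<noteq> snd p \<longrightarrow>
      avg n (\<lambda>t. ip (x (t + fst p)) (x (t + snd p))) \<le> c"
    using assms(5) by (intro eventually_ball_finite) (auto simp: eventually_conj_iff)
  moreover have "\<forall>\<^sub>F n in sequentially. n > (0::nat)"
    by (rule eventually_gt_at_top)
  ultimately show ?thesis
  proof eventually_elim
    case (elim n)
    define y where "y = (\<lambda>t. avg S (\<lambda>s. x (t + s)))"
    have sw: "avg n y = avg S (\<lambda>s. avg n (\<lambda>t. x (t + s)))"
      unfolding y_def avg_def scaleR_sum_right by (subst sum.swap) (simp add: mult.commute)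
    have "avg n y - avg n x = avg S (\<lambda>s. avg n (\<lambda>t. x (t + s)) - avg n x)"
      unfolding sw avg_diff using assms(4) by (simp add: avg_const)
    then have 1: "nrm (avg n y - avg n x) \<le> e"
      using elim assms(3) by (auto intro!: nrm_avg_le)
    have diag: "avg n (\<lambda>t. ip (x (t + s)) (x (t + s))) \<le> K\<^sup>2" for s
    proof -
      have "ip (x (t + s)) (x (t + s)) \<le> K\<^sup>2" for t
        unfolding nrm_sq[symmetric] using assms(1) by (rule power_mono) simp
      then have "(\<Sum>t<n. ip (x (t + s)) (x (t + s))) \<le> real n * K\<^sup>2"
        using sum_bounded_above[of "{..<n}" "\<lambda>t. ip (x (t + s)) (x (t + s))" "K\<^sup>2"] by simp
      then show ?thesis using elim by (simp add: avg_def field_simps)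
    qed
    have "ip (avg n y) (avg n y) \<le> avg n (\<lambda>t. ip (y t) (y t))"
      by (rule ip_avg_avg_le)
    also have "\<dots> = (1 / (real S)\<^sup>2) * (\<Sum>s<S. \<Sum>s'<S. avg n (\<lambda>t. ip (x (t + s)) (x (t + s'))))"
    proof -
      have "ip (y t) (y t) = (1 / (real S)\<^sup>2) *\<^sub>R (\<Sum>s<S. \<Sum>s'<S. ip (x (t + s)) (x (t + s')))" for t
      proof -
        have "ip (\<Sum>s<S. x (t + s)) (\<Sum>s<S. x (t + s)) = (\<Sum>s<S. \<Sum>s'<S. ip (x (t + s)) (x (t + s')))"
          by (simp only: ip_sum_left) (simp only: ip_sum_right)
        then show ?thesis
          unfolding y_def avg_def ip_scale_left ip_scale_right by (simp add: power2_eq_square)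
      qed
      then have "avg n (\<lambda>t. ip (y t) (y t)) =
          avg n (\<lambda>t. (1 / (real S)\<^sup>2) *\<^sub>R (\<Sum>s<S. \<Sum>s'<S. ip (x (t + s)) (x (t + s'))))"
        by presburger
      then show ?thesis by (simp only: avg_scale avg_sum) (simp only: real_scaleR_def)
    qed
    \<comment> \<open>Since \<open>c \<ge> 0\<close>, adding \<open>c\<close> on the diagonal too is
      harmless and gives all pairs one formula.\<close>
    also have "\<dots> \<le> (1 / (real S)\<^sup>2) * (\<Sum>s<S. \<Sum>s'<S. (if s' = s then K\<^sup>2 else 0) + c)"
      using elim assms(6) add_mono[OF diag assms(6)] by (intro mult_left_mono sum_mono) auto
    also have "\<dots> = K\<^sup>2 / S + c"
      using assms(4) by (simp add: sum.distrib field_simps power2_eq_square)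
    finally have "nrm (avg n y) \<le> sqrt (K\<^sup>2 / S + c)"
      unfolding nrm_def by (rule real_sqrt_le_mono)
    then show "nrm (avg n x) \<le> e + sqrt (K\<^sup>2 / S + c)"
      using 1 nrm_diff[of "avg n y" "avg n y - avg n x"] by simp
  qed
qed

end

section \<open>Orthogonal actions and almost minimal vectors\<close>

text \<open>The acting group is the additive group of a commutative ring, so that integer multiples
  and polynomials with group elements as coefficients are available. The vector \<open>f\<close>
  whose correlations are studied is fixed throughout.\<close>

locale orthogonal_action = semi_inner ip
  for ip :: "'v::real_vector \<Rightarrow> 'v \<Rightarrow> real" +
  fixes T :: "'g::comm_ring_1 \<Rightarrow> 'v \<Rightarrow> 'v" and f :: 'v
  assumes T_add: "T g (u + v) = T g u + T g v"
    and T_scale: "T g (c *\<^sub>R u) = c *\<^sub>R T g u"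
    and T_plus: "T (g + h) u = T g (T h u)"
    and T_zero: "T 0 u = u"
    and ip_T: "ip (T g u) (T g v) = ip u v"
    and ip_f_le: "ip f f \<le> 1"
begin

lemma T_diff: "T g (u - v) = T g u - T g v"
  using T_add[of g u "(-1) *\<^sub>R v"] T_scale[of g "-1" v] by simp

lemma T_sum: "T g (\<Sum>i\<in>I. x i) = (\<Sum>i\<in>I. T g (x i))"
proof (induction I rule: infinite_finite_induct)
  have "T g 0 = 0" using T_scale[of g 0 0] by simp
  then show "T g (sum x {}) = (\<Sum>i\<in>{}. T g (x i))" "\<And>I. infinite I \<Longrightarrow> T g (sum x I) = (\<Sum>i\<in>I. T g (x i))" by auto
qed (auto simp: T_add)

lemma T_avg: "T g (avg n x) = avg n (\<lambda>t. T g (x t))"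
  by (simp add: avg_def T_scale T_sum)

lemma nrm_T: "nrm (T g u) = nrm u"
  by (simp add: nrm_def ip_T)

lemma nrm_f_le: "nrm f \<le> 1"
  by (simp add: nrm_def ip_f_le)

lemma linear_T: "linear (T g)"
  by (rule linearI) (simp_all add: T_add T_scale)

lemma convex_nrm_le: "linear h \<Longrightarrow> convex {u. nrm (h u) \<le> K}"
proof (rule convexI)
  fix u v :: 'a and a b :: real
  assume h: "linear h" and uv: "u \<in> {u. nrm (h u) \<le> K}" "v \<in> {u. nrm (h u) \<le> K}" and ab: "0 \<le> a" "0 \<le> b" "a + b = 1"
  have "nrm (h (a *\<^sub>R u + b *\<^sub>R v)) \<le> a * nrm (h u) + b * nrm (h v)"
    using nrm_add[of "a *\<^sub>R h u" "b *\<^sub>R h v"] ab h by (simp add: linear_add linear_scale nrm_scale)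
  also have "\<dots> \<le> a * K + b * K"
    using uv ab by (intro add_mono mult_left_mono) auto
  finally show "a *\<^sub>R u + b *\<^sub>R v \<in> {u. nrm (h u) \<le> K}"
    using ab by (simp flip: distrib_right)
qed

section \<open>Convex hulls of orbits and their almost minimal vectors\<close>

definition Orb :: "'g set \<Rightarrow> 'v set" where
  "Orb S = convex hull ((\<lambda>g. T g f) ` S)"

definition minsq :: "'g set \<Rightarrow> real" where
  "minsq S = (INF u\<in>Orb S. ip u u)"

definition near :: "'g set \<Rightarrow> real \<Rightarrow> 'v \<Rightarrow> bool" where
  "near S e u \<longleftrightarrow> u \<in> Orb S \<and> ip u u \<le> minsq S + e"

definition addclosed :: "'g set \<Rightarrow> bool" where
  "addclosed S \<longleftrightarrow> 0 \<in> S \<and> (\<forall>x\<in>S. \<forall>y\<in>S. x + y \<in> S)"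

lemma convex_Orb: "convex (Orb S)"
  by (simp add: Orb_def)

lemma Orb_mono: "S \<subseteq> S' \<Longrightarrow> Orb S \<subseteq> Orb S'"
  unfolding Orb_def by (intro hull_mono image_mono)

lemma T_in_Orb: "g \<in> S \<Longrightarrow> T g f \<in> Orb S"
  unfolding Orb_def by (intro hull_inc imageI)

lemma Orb_induct:
  assumes "u \<in> Orb S" "convex {u. P u}" "\<And>g. g \<in> S \<Longrightarrow> P (T g f)"
  shows "P u"
proof -
  have "Orb S \<subseteq> {u. P u}"
    unfolding Orb_def using assms(2,3) by (intro hull_minimal) auto
  then show ?thesis using assms(1) by auto
qed

lemma T_Orb:
  assumes "addclosed S" "g \<in> S" "u \<in> Orb S"
  shows "T g u \<in> Orb S"
proof -
  have "convex (T g -` Orb S)"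
    using convex_linear_vimage[OF linear_T convex_Orb] .
  then show ?thesis
    by (intro Orb_induct[OF assms(3), where P="\<lambda>u. T g u \<in> Orb S"])
       (use assms in \<open>auto simp: vimage_def T_plus[symmetric] addclosed_def intro: T_in_Orb\<close>)
qed

lemma nrm_Orb: "u \<in> Orb S \<Longrightarrow> nrm u \<le> 1"
  using convex_nrm_le[OF linear_ident, of 1] nrm_f_le
  by (elim Orb_induct) (auto simp: nrm_T)

lemma minsq_bdd: "bdd_below ((\<lambda>u. ip u u) ` Orb S)"
  using ip_nonneg by (intro bdd_belowI[of _ 0]) auto

lemma minsq_le: "u \<in> Orb S \<Longrightarrow> minsq S \<le> ip u u"
  unfolding minsq_def by (rule cINF_lower[OF minsq_bdd])

lemma minsq_nonneg: "0 \<in> S \<Longrightarrow> 0 \<le> minsq S"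
  unfolding minsq_def using T_in_Orb[of 0 S] by (intro cINF_greatest) (auto simp: ip_nonneg)

lemma minsq_le_1: "0 \<in> S \<Longrightarrow> minsq S \<le> 1"
  using minsq_le[OF T_in_Orb[of 0 S]] ip_f_le by (simp add: T_zero)

lemma minsq_antimono_Orb: "Orb S \<subseteq> Orb S' \<Longrightarrow> 0 \<in> S \<Longrightarrow> minsq S' \<le> minsq S"
  unfolding minsq_def using T_in_Orb[of 0 S]
  by (intro cINF_superset_mono minsq_bdd) auto

lemma minsq_antimono: "S \<subseteq> S' \<Longrightarrow> 0 \<in> S \<Longrightarrow> minsq S' \<le> minsq S"
  by (rule minsq_antimono_Orb[OF Orb_mono])

lemma near_exists:
  assumes "0 \<in> S" "e > 0"
  shows "\<exists>u. near S e u"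
proof -
  have "Orb S \<noteq> {}" using T_in_Orb[OF assms(1)] by auto
  then obtain u where "u \<in> Orb S" "ip u u < minsq S + e"
    using cINF_less_iff[OF _ minsq_bdd, of S "minsq S + e"] assms(2) unfolding minsq_def by auto
  then show ?thesis unfolding near_def by (auto intro: less_imp_le)
qed

text \<open>Parallelogram law: the midpoint of two almost minimal vectors is again in the convex set.\<close>
lemma near_unique:
  assumes "near S e u" "near S e' v"
  shows "nrm (u - v) \<le> sqrt (2 * (e + e'))"
proof -
  have "(1/2) *\<^sub>R u + (1/2) *\<^sub>R v \<in> Orb S"
    using assms convexD[OF convex_Orb, of u S v "1/2" "1/2"] by (simp add: near_def)
  then have "minsq S \<le> ip ((1/2) *\<^sub>R u + (1/2) *\<^sub>R v) ((1/2) *\<^sub>R u + (1/2) *\<^sub>R v)"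
    by (rule minsq_le)
  then have "4 * minsq S \<le> ip u u + 2 * ip u v + ip v v"
    by (simp add: ip_add_left ip_add_right ip_scale_left ip_scale_right ip_commute[of v u] field_simps)
  then have "ip (u - v) (u - v) \<le> 2 * (e + e')"
    using assms by (simp add: near_def ip_diff_left ip_diff_right ip_commute[of v u])
  then show ?thesis unfolding nrm_def by (rule real_sqrt_le_mono)
qed

lemma near_T:
  assumes "addclosed S" "g \<in> S" "near S e u"
  shows "near S e (T g u)"
  using assms T_Orb[of S g u] by (simp add: near_def ip_T)

text \<open>Translation by \<open>g\<close> maps almost minimal vectors to almost minimal vectors,
  so almost uniqueness becomes almost invariance.\<close>

lemma near_invariant:
  assumes "addclosed S" "g \<in> S" "near S e u"
  shows "nrm (T g u - u) \<le> 2 * sqrt e"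
proof -
  have "sqrt (2 * (e + e)) = 2 * sqrt e"
    using real_sqrt_mult[of 4 e] by simp
  then show ?thesis using near_unique[OF near_T[OF assms] assms(3)] by simp
qed

lemma near_avg:
  assumes "addclosed S" "near S e u" "n > 0" "\<And>t. g t \<in> S"
  shows "near S e (avg n (\<lambda>t. T (g t) u))"
proof -
  have "avg n (\<lambda>t. T (g t) u) \<in> Orb S"
    using assms by (intro avg_in_convex[OF convex_Orb]) (auto simp: near_def intro: T_Orb)
  moreover have "nrm (avg n (\<lambda>t. T (g t) u)) \<le> nrm u"
    by (intro nrm_avg_le) (auto simp: nrm_T)
  ultimately show ?thesis
    using assms(2) unfolding near_def nrm_def by simp
qed

section \<open>Averages along arithmetic progressions in the group\<close>

lemma linear_shift_avg:
  assumes "e > 0"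
  shows "\<forall>\<^sub>F n in sequentially.
    nrm (avg n (\<lambda>t. T (of_nat t * C) (T (of_int s * C) u)) - avg n (\<lambda>t. T (of_nat t * C) u)) \<le> e"
proof -
  have nonneg: "\<forall>\<^sub>F n in sequentially.
    nrm (avg n (\<lambda>t. T (of_nat t * C) (T (of_nat s * C) u)) - avg n (\<lambda>t. T (of_nat t * C) u)) \<le> e" for s
    using nrm_tendsto_shift_avg[of "nrm u" "\<lambda>t. T (of_nat t * C) u" e s] assms
    by (simp add: nrm_T T_plus[symmetric] distrib_right)
  show ?thesis
  proof (cases "s \<ge> 0")
    case True
    then show ?thesis using nonneg[of "nat s"] by simp
  next
    \<comment> \<open>A negative shift reduces to a positive one: the isometry
      \<open>T (of_nat r * C)\<close> turns one difference into the negative of the other.\<close>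
    case False
    define r where "r = nat (- s)"
    have s: "of_int s = - (of_nat r :: 'g)"
      using False unfolding r_def by simp
    have "nrm (avg n (\<lambda>t. T (of_nat t * C) (T (of_int s * C) u)) - avg n (\<lambda>t. T (of_nat t * C) u))
      = nrm (avg n (\<lambda>t. T (of_nat t * C) (T (of_nat r * C) u)) - avg n (\<lambda>t. T (of_nat t * C) u))" for n
    proof -
      have "T (of_nat r * C) (avg n (\<lambda>t. T (of_nat t * C) (T (of_int s * C) u)) - avg n (\<lambda>t. T (of_nat t * C) u))
        = avg n (\<lambda>t. T (of_nat t * C) u) - avg n (\<lambda>t. T (of_nat t * C) (T (of_nat r * C) u))"
        by (simp add: T_diff T_avg T_plus[symmetric] s algebra_simps)
      then show ?thesis
        by (metis nrm_T nrm_minus minus_diff_eq)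
    qed
    then show ?thesis using nonneg[of r] by simp
  qed
qed

text \<open>An almost minimal \<open>w\<close> for \<open>S'\<close> is a convex combination of
  translates of \<open>f\<close> by elements \<open>h + s C\<close>. The same combination applied to
  \<open>u\<close> is no longer than \<open>w\<close>, and averaging along \<open>C\<close> hardly
  distinguishes it from \<open>u\<close>: the \<open>h\<close> part almost fixes \<open>u\<close> at
  cost \<open>2 * sqrt e\<close>, and the shift by \<open>s C\<close> is absorbed by the average at
  cost \<open>d\<close>.\<close>

lemma nrm_linear_avg_le:
  assumes S: "addclosed S" "near S e u" and S': "0 \<in> S'"
    and dec: "\<And>g. g \<in> S' \<Longrightarrow> \<exists>h\<in>S. \<exists>s::int. g = h + of_int s * C"
    and d: "d > 0"
  shows "\<forall>\<^sub>F n in sequentially.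
    nrm (avg n (\<lambda>t. T (of_nat t * C) u)) \<le> sqrt (minsq S' + d) + 2 * sqrt e + d"
proof -
  obtain w where w: "near S' d w" using near_exists[OF S' d] by blast
  then obtain k :: nat and c x where c: "\<And>i. i \<in> {1..k} \<Longrightarrow> 0 \<le> c i \<and> x i \<in> (\<lambda>g. T g f) ` S'"
    "sum c {1..k} = 1" "(\<Sum>i = 1..k. c i *\<^sub>R x i) = w"
    unfolding near_def Orb_def convex_hull_indexed by blast
  have "\<exists>h s. \<forall>i\<in>{1..k}. h i \<in> S \<and> x i = T (h i + of_int (s i) * C) f"
  proof -
    have "\<forall>i\<in>{1..k}. \<exists>h s. h \<in> S \<and> x i = T (h + of_int s * C) f"
      using c(1) dec by fast
    then show ?thesis by metis
  qed
  then obtain h s where hs: "\<And>i. i \<in> {1..k} \<Longrightarrow> h i \<in> S" "\<And>i. i \<in> {1..k} \<Longrightarrow> x i = T (h i + of_int (s i) * C) f"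
    by blast
  \<comment> \<open>The convex combination producing \<open>w\<close> from \<open>f\<close>, made
    into an operator. It commutes with every \<open>T g\<close>, so its bound at \<open>f\<close>
    spreads to all translates and, by convexity, to the hull.\<close>
  define \<Lambda> where "\<Lambda> = (\<lambda>v. \<Sum>i = 1..k. c i *\<^sub>R T (h i + of_int (s i) * C) v)"
  have lin: "linear \<Lambda>"
    by (rule linearI) (simp_all add: \<Lambda>_def T_add T_scale scaleR_right_distrib sum.distrib
        scaleR_sum_right mult.commute)
  have \<Lambda>f: "\<Lambda> f = w" using c hs by (simp add: \<Lambda>_def)
  have comm: "\<Lambda> (T g v) = T g (\<Lambda> v)" for g v
    by (simp add: \<Lambda>_def T_sum T_scale T_plus[symmetric] add.commute)
  have "nrm (\<Lambda> u) \<le> nrm w"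
    using S(2) unfolding near_def
    by (intro Orb_induct[of u S, where P="\<lambda>u. nrm (\<Lambda> u) \<le> nrm w"] convex_nrm_le[OF lin])
       (auto simp: comm nrm_T \<Lambda>f)
  also have "\<dots> \<le> sqrt (minsq S' + d)"
    using w unfolding nrm_def near_def by simp
  finally have \<Lambda>u: "nrm (\<Lambda> u) \<le> sqrt (minsq S' + d)" .
  have "\<forall>\<^sub>F n in sequentially. \<forall>i\<in>{1..k}.
    nrm (avg n (\<lambda>t. T (of_nat t * C) (T (of_int (s i) * C) u)) - avg n (\<lambda>t. T (of_nat t * C) u)) \<le> d"
    using d by (intro eventually_ball_finite ballI linear_shift_avg) auto
  then show ?thesis
  proof eventually_elim
    case (elim n)
    let ?a = "\<lambda>v. avg n (\<lambda>t. T (of_nat t * C) v)"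
    have a_le: "nrm (?a v) \<le> nrm v" for v
      by (intro nrm_avg_le) (auto simp: nrm_T)
    have "?a (\<Lambda> u) = (\<Sum>i = 1..k. c i *\<^sub>R ?a (T (h i + of_int (s i) * C) u))"
      by (simp add: \<Lambda>_def T_sum T_scale avg_sum avg_scale)
    moreover have "?a u = (\<Sum>i = 1..k. c i *\<^sub>R ?a u)"
      using c(2) by (simp flip: scaleR_sum_left)
    ultimately have "?a (\<Lambda> u) - ?a u = (\<Sum>i = 1..k. c i *\<^sub>R (?a (T (h i + of_int (s i) * C) u) - ?a u))"
      by (simp add: sum_subtractf scaleR_right_diff_distrib)
    also have "nrm \<dots> \<le> (\<Sum>i = 1..k. c i * (2 * sqrt e + d))"
    proof (rule order_trans[OF nrm_sum], rule sum_mono)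
      fix i assume i: "i \<in> {1..k}"
      have "?a (T (h i + of_int (s i) * C) u) - ?a (T (of_int (s i) * C) u)
          = ?a (T (of_int (s i) * C) (T (h i) u - u))"
        by (simp add: avg_diff T_diff T_plus[symmetric] add.commute)
      then have "nrm (?a (T (h i + of_int (s i) * C) u) - ?a (T (of_int (s i) * C) u)) \<le> 2 * sqrt e"
        using a_le[of "T (of_int (s i) * C) (T (h i) u - u)"] near_invariant[OF S(1) hs(1)[OF i] S(2)]
        by (simp add: nrm_T)
      then have "nrm (?a (T (h i + of_int (s i) * C) u) - ?a u) \<le> 2 * sqrt e + d"
        using elim i nrm_diff_triangle[of "?a (T (h i + of_int (s i) * C) u)" "?a u" "?a (T (of_int (s i) * C) u)"]
        by force
      then show "nrm (c i *\<^sub>R (?a (T (h i + of_int (s i) * C) u) - ?a u)) \<le> c i * (2 * sqrt e + d)"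
        using c(1)[OF i] by (simp add: nrm_scale mult_left_mono)
    qed
    also have "\<dots> = 2 * sqrt e + d"
      using c(2) by (simp flip: sum_distrib_right)
    finally have "nrm (?a (\<Lambda> u) - ?a u) \<le> 2 * sqrt e + d" .
    moreover have "nrm (?a u) \<le> nrm (?a (\<Lambda> u)) + nrm (?a (\<Lambda> u) - ?a u)"
      using nrm_diff[of "?a (\<Lambda> u)" "?a (\<Lambda> u) - ?a u"] by simp
    ultimately show "nrm (?a u) \<le> sqrt (minsq S' + d) + 2 * sqrt e + d"
      using a_le[of "\<Lambda> u"] \<Lambda>u by linarith
  qed
qed

text \<open>The minimum for \<open>S'\<close> barely exceeds that for the larger set
  \<open>S1\<close>. Hence the average of \<open>u\<close>, which lies in \<open>Orb S1\<close> and
  is short by \<open>nrm_linear_avg_le\<close>, is almost minimal for \<open>S1\<close>. So is the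
  average of \<open>v\<close>, and almost minimal vectors are close.\<close>

lemma nrm_linear_avg_diff_le:
  assumes S: "addclosed S" "near S e u" and S': "0 \<in> S'"
    and dec: "\<And>g. g \<in> S' \<Longrightarrow> \<exists>h\<in>S. \<exists>s::int. g = h + of_int s * C"
    and S1: "addclosed S1" "near S1 e v" "S \<subseteq> S1" "\<And>t. of_nat t * C \<in> S1"
    and m: "minsq S' \<le> minsq S1 + e"
    and e: "0 < e" "e \<le> 1"
  shows "\<forall>\<^sub>F n in sequentially. nrm (avg n (\<lambda>t. T (of_nat t * C) (u - v))) \<le> sqrt (48 * sqrt e)"
proof -
  have "\<forall>\<^sub>F n in sequentially. n > (0::nat)"
    by (rule eventually_gt_at_top)
  moreover have "\<forall>\<^sub>F n in sequentially.
      nrm (avg n (\<lambda>t. T (of_nat t * C) u)) \<le> sqrt (minsq S' + e) + 2 * sqrt e + e"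
    using nrm_linear_avg_le[OF S S' _ e(1)] dec by blast
  ultimately show ?thesis
  proof eventually_elim
    case (elim n)
    let ?a = "\<lambda>v. avg n (\<lambda>t. T (of_nat t * C) v)"
    have se: "e \<le> sqrt e" "sqrt e \<le> 1"
      using e by (auto intro: real_le_rsqrt simp: power2_eq_square mult_left_le_one_le)
    have m1: "0 \<le> minsq S1" "minsq S1 \<le> 1"
      using S1(1) minsq_nonneg minsq_le_1 by (auto simp: addclosed_def)
    define q where "q = sqrt (minsq S1 + 2 * e)"
    have q: "0 \<le> q" "q\<^sup>2 = minsq S1 + 2 * e" "q \<le> 2"
      using m1 e unfolding q_def by (auto intro!: real_le_lsqrt)
    have "sqrt (minsq S' + e) \<le> q"
      using m unfolding q_def by simp
    then have "nrm (?a u) \<le> q + 3 * sqrt e"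
      using elim se by linarith
    then have "(nrm (?a u))\<^sup>2 \<le> (q + 3 * sqrt e)\<^sup>2"
      by (intro power_mono) auto
    also have "\<dots> = minsq S1 + 11 * e + 6 * q * sqrt e"
      using e by (simp add: power2_sum power_mult_distrib q algebra_simps)
    \<comment> \<open>From \<open>q \<le> 2\<close> and \<open>e \<le> sqrt e\<close> the excess is
      at most \<open>(11 + 12) * sqrt e\<close>. In \<open>near_unique\<close> this becomes
      \<open>2 * (23 + 1) = 48\<close>.\<close>
    also have "\<dots> \<le> minsq S1 + 23 * sqrt e"
    proof -
      have "q * sqrt e \<le> 2 * sqrt e" using q(3) e by (intro mult_right_mono) auto
      then show ?thesis using se by linarith
    qed
    finally have "ip (?a u) (?a u) \<le> minsq S1 + 23 * sqrt e"
      by (simp add: nrm_sq)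
    moreover have "?a u \<in> Orb S1"
    proof (rule avg_in_convex[OF convex_Orb])
      show "n > 0" by (rule elim)
      have "u \<in> Orb S1" using S(2) Orb_mono[OF S1(3)] by (auto simp: near_def)
      then show "T (of_nat t * C) u \<in> Orb S1" for t
        using T_Orb[OF S1(1) S1(4)] by simp
    qed
    ultimately have "near S1 (23 * sqrt e) (?a u)"
      by (simp add: near_def)
    moreover have "near S1 e (?a v)"
      by (rule near_avg[OF S1(1,2) elim(1) S1(4)])
    ultimately have "nrm (?a u - ?a v) \<le> sqrt (2 * (23 * sqrt e + e))"
      by (rule near_unique)
    also have "\<dots> \<le> sqrt (48 * sqrt e)"
      using se by simp
    finally show "nrm (?a (u - v)) \<le> sqrt (48 * sqrt e)"
      by (simp add: T_diff avg_diff)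
  qed
qed

end

section \<open>Polynomial averages\<close>

text \<open>\<open>lead D C P\<close> is the finite-difference form of ``\<open>P\<close> is a polynomial of degree \<open>D + 1\<close>
  whose leading coefficient times \<open>(D + 1)!\<close> is \<open>C\<close>''.\<close>

fun lead :: "nat \<Rightarrow> 'g::comm_ring_1 \<Rightarrow> (nat \<Rightarrow> 'g) \<Rightarrow> bool" where
  "lead 0 C P \<longleftrightarrow> (\<forall>t. P t = P 0 + of_nat t * C)"
| "lead (Suc D) C P \<longleftrightarrow> (\<forall>s s'. s \<noteq> s' \<longrightarrow>
     lead D (of_int (int s - int s') * C) (\<lambda>t. P (t + s) - P (t + s')))"

text \<open>The two top terms of the substitution \<open>a + b X\<close>. It is used with
  \<open>b = 1\<close> to compute differences of shifts and with \<open>b = l\<close> to restrict to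
  a residue class modulo \<open>l\<close>.\<close>

lemma coeff_pcompose_linear:
  fixes p :: "'a::comm_ring_1 poly"
  assumes "degree p \<le> Suc n"
  shows "coeff (pcompose p [:a, b:]) n = b ^ n * (coeff p n + of_nat (Suc n) * a * coeff p (Suc n))"
  using assms
proof (induction p arbitrary: n)
  case (pCons x p)
  have deg: "degree p \<le> n"
    using pCons.prems by (auto simp: degree_pCons_eq_if split: if_splits)
  have top: "coeff (pcompose p [:a, b:]) n = b ^ n * coeff p n"
    using pCons.IH[of n] deg by (simp add: coeff_eq_0)
  show ?case
  proof (cases n)
    case 0
    then show ?thesis using top by (simp add: pcompose_pCons)
  next
    case (Suc m)
    have "coeff (pcompose p [:a, b:]) m = b ^ m * (coeff p m + of_nat (Suc m) * a * coeff p (Suc m))"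
      using pCons.IH[of m] deg Suc by simp
    then show ?thesis using top Suc by (simp add: pcompose_pCons algebra_simps)
  qed
qed simp

text \<open>In a difference of two shifts the top coefficients cancel. The next one is the old top
  coefficient times the degree and \<open>s - s'\<close>; the degrees met along the induction
  multiply up to the factorial.\<close>

lemma lead_poly:
  fixes p :: "'g::comm_ring_1 poly"
  assumes "degree p \<le> Suc D"
  shows "lead D (of_nat (fact (Suc D)) * coeff p (Suc D)) (\<lambda>t. poly p (of_nat t))"
  using assms
proof (induction D arbitrary: p)
  case 0
  have "p = [:coeff p 0, coeff p 1:]"
    using 0 by (intro poly_eqI) (auto simp: coeff_pCons coeff_eq_0 split: nat.split)
  then have "poly p x = coeff p 0 + x * coeff p 1" for x
    by (metis mult_zero_right add_0_right poly_0 poly_pCons)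
  then show ?case by simp
next
  case (Suc D)
  show ?case unfolding lead.simps
  proof (intro allI impI)
    fix s s' :: nat
    define q where "q = (\<lambda>s::nat. pcompose p [:of_nat s, 1:])"
    have degq: "degree (q s) \<le> Suc (Suc D)" for s
      using degree_pcompose_le[of p "[:of_nat s, 1:]"] Suc.prems unfolding q_def by simp
    have cq: "coeff (q s) (Suc (Suc D)) = coeff p (Suc (Suc D))" for s
      unfolding q_def using Suc.prems by (subst coeff_pcompose_linear) (auto simp: coeff_eq_0)
    have cq': "coeff (q s) (Suc D) = coeff p (Suc D) + of_nat (Suc (Suc D)) * of_nat s * coeff p (Suc (Suc D))" for s
      unfolding q_def using Suc.prems by (subst coeff_pcompose_linear) auto
    define h where "h = q s - q s'"
    have "coeff h i = 0" if "i > Suc D" for i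
    proof (cases "i = Suc (Suc D)")
      case False
      then have "coeff (q s) i = 0" for s
        using that le_less_trans[OF degq, of i s] by (intro coeff_eq_0) simp
      then show ?thesis by (simp add: h_def)
    qed (simp add: h_def cq)
    then have "degree h \<le> Suc D" by (intro degree_le) auto
    from Suc.IH[OF this]
    have "lead D (of_nat (fact (Suc D)) * coeff h (Suc D)) (\<lambda>t. poly h (of_nat t))" .
    moreover have "of_nat (fact (Suc D)) * coeff h (Suc D)
        = of_int (int s - int s') * (of_nat (fact (Suc (Suc D))) * coeff p (Suc (Suc D)))"
      unfolding h_def coeff_diff cq' fact_Suc[of "Suc D"] by (simp add: algebra_simps del: fact_Suc)
    moreover have "(\<lambda>t. poly h (of_nat t)) = (\<lambda>t. poly p (of_nat (t + s)) - poly p (of_nat (t + s')))"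
      by (simp add: h_def q_def poly_pcompose add.commute)
    ultimately show "lead D (of_int (int s - int s') * (of_nat (fact (Suc (Suc D))) * coeff p (Suc (Suc D))))
        (\<lambda>t. poly p (of_nat (t + s)) - poly p (of_nat (t + s')))" by simp
  qed
qed

text \<open>Each \<open>m i\<close> is bounded and increases along divisibility, so some multiple
  comes within \<open>e\<close> of the supremum. Treating the indices one after another loses
  nothing: after passing to \<open>l * x\<close>, an earlier index satisfies
  \<open>m i (l * x * l') \<le> m i l + e \<le> m i (l * x) + e\<close>.\<close>

lemma stable_multiple:
  fixes m :: "nat \<Rightarrow> nat \<Rightarrow> real"
  assumes mono: "\<And>i l l'. l > 0 \<Longrightarrow> l' > 0 \<Longrightarrow> m i l \<le> m i (l * l')"
    and bdd: "\<And>i l. l > 0 \<Longrightarrow> m i l \<le> 1" and k: "k > 0" and e: "e > 0"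
  shows "\<exists>l>0. k dvd l \<and> (\<forall>i<N. \<forall>l'>0. m i (l * l') \<le> m i l + e)"
proof (induction N)
  case 0
  then show ?case using k by auto
next
  case (Suc N)
  then obtain l where l: "l > 0" "k dvd l" "\<And>i l'. i < N \<Longrightarrow> l' > 0 \<Longrightarrow> m i (l * l') \<le> m i l + e" by blast
  define A where "A = (\<lambda>x. m N (l * x)) ` {0<..}"
  have A: "bdd_above A" "A \<noteq> {}"
    using l(1) bdd by (auto simp: A_def intro!: bdd_aboveI[of _ 1])
  then obtain y where "y \<in> A" "Sup A - e < y"
    using less_cSup_iff[of A "Sup A - e"] e by auto
  then obtain x where x: "x > 0" "Sup A - e < m N (l * x)" by (auto simp: A_def)
  have "m i (l * x * l') \<le> m i (l * x) + e" if "i < Suc N" "l' > 0" for i l'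
  proof (cases "i = N")
    case True
    have "m N (l * (x * l')) \<le> Sup A"
      using A(1) x(1) that by (intro cSup_upper) (auto simp: A_def)
    then show ?thesis using True x(2) by (simp add: mult.assoc)
  next
    case False
    then have "m i (l * (x * l')) \<le> m i l + e" using l(3) that x(1) by simp
    also have "m i l \<le> m i (l * x)" using mono l(1) x(1) by simp
    finally show ?thesis by (simp add: mult.assoc)
  qed
  then show ?case using l x(1) by (intro exI[of _ "l * x"]) auto
qed

section \<open>A quantitative Weyl estimate and the decomposition along the lattice chain\<close>

context orthogonal_action
begin

text \<open>The threshold \<open>\<kappa>\<close> is uniform in \<open>C\<close>, \<open>P\<close>
  and \<open>w\<close>, so it can be fixed before the accuracy of the almost minimal vectors. The
  bound 2 fits a difference of two vectors from orbit hulls.\<close>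

definition weyl_const :: "nat \<Rightarrow> real \<Rightarrow> real \<Rightarrow> bool" where
  "weyl_const D e \<kappa> \<longleftrightarrow> (\<forall>C P w. lead D C P \<longrightarrow> nrm w \<le> 2 \<longrightarrow>
     (\<forall>z::int. z \<noteq> 0 \<longrightarrow>
       (\<forall>\<^sub>F n in sequentially. nrm (avg n (\<lambda>t. T (of_nat t * (of_int z * C)) w)) \<le> \<kappa>)) \<longrightarrow>
     (\<forall>\<^sub>F n in sequentially. nrm (avg n (\<lambda>t. T (P t) w)) \<le> e))"

lemma weyl_constD:
  assumes "weyl_const D e \<kappa>" "lead D C P" "nrm w \<le> 2"
    and "\<And>z::int. z \<noteq> 0 \<Longrightarrow>
      \<forall>\<^sub>F n in sequentially. nrm (avg n (\<lambda>t. T (of_nat t * (of_int z * C)) w)) \<le> \<kappa>"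
  shows "\<forall>\<^sub>F n in sequentially. nrm (avg n (\<lambda>t. T (P t) w)) \<le> e"
  by (rule assms(1)[unfolded weyl_const_def, THEN spec[where x=C], THEN spec[where x=P],
        THEN spec[where x=w], THEN mp, OF assms(2), THEN mp, OF assms(3), THEN mp])
     (intro allI impI assms(4))

lemma ip_T_diff: "ip (T g u) (T h u) = ip u (T (g - h) u)"
proof -
  have "ip (T h u) (T h (T (g - h) u)) = ip u (T (g - h) u)" by (rule ip_T)
  then show ?thesis by (simp add: T_plus[symmetric] ip_commute)
qed

text \<open>Induction on the degree by van der Corput: the correlation of two shifts is an average
  along a difference of \<open>P\<close>, of lower degree, whose leading term is a nonzero integer
  multiple of \<open>C\<close>. Demanding smallness for all nonzero multiples \<open>z\<close> makes
  the hypothesis pass on to it.\<close>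

lemma weyl_const_exists:
  assumes "e > 0"
  shows "\<exists>\<kappa>>0. weyl_const D e \<kappa>"
  using assms
proof (induction D arbitrary: e)
  case 0
  have "weyl_const 0 e e" unfolding weyl_const_def
  proof (intro allI impI)
    fix C P w
    assume P: "lead 0 C P" and *: "\<forall>z::int. z \<noteq> 0 \<longrightarrow>
       (\<forall>\<^sub>F n in sequentially. nrm (avg n (\<lambda>t. T (of_nat t * (of_int z * C)) w)) \<le> e)"
    have "T (P t) w = T (P 0) (T (of_nat t * C) w)" for t
      using P unfolding lead.simps by (metis T_plus)
    then have "avg n (\<lambda>t. T (P t) w) = T (P 0) (avg n (\<lambda>t. T (of_nat t * C) w))" for n
      unfolding T_avg by presburger
    then have "nrm (avg n (\<lambda>t. T (P t) w)) = nrm (avg n (\<lambda>t. T (of_nat t * C) w))" for n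
      by (simp add: nrm_T)
    then show "\<forall>\<^sub>F n in sequentially. nrm (avg n (\<lambda>t. T (P t) w)) \<le> e"
      using *[rule_format, of 1] by simp
  qed
  then show ?case using 0 by blast
next
  case (Suc D)
  have "e\<^sup>2 / 16 > 0" using Suc.prems by simp
  from Suc.IH[OF this] obtain \<kappa> where \<kappa>: "\<kappa> > 0" "weyl_const D (e\<^sup>2 / 16) \<kappa>"
    by blast
  have "weyl_const (Suc D) e \<kappa>" unfolding weyl_const_def
  proof (intro allI impI)
    fix C P w
    assume P: "lead (Suc D) C P" and w: "nrm w \<le> 2" and *: "\<forall>z::int. z \<noteq> 0 \<longrightarrow>
       (\<forall>\<^sub>F n in sequentially. nrm (avg n (\<lambda>t. T (of_nat t * (of_int z * C)) w)) \<le> \<kappa>)"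
    \<comment> \<open>This makes \<open>4 / S\<close> at most \<open>e^2 / 8\<close>. With the
      correlation bound \<open>2 * (e^2 / 16)\<close> the root is at most \<open>e / 2\<close>, and
      the other \<open>e / 2\<close> pays for the shifts.\<close>
    obtain S :: nat where S: "real S > 32 / e\<^sup>2" using reals_Archimedean2 by blast
    have Spos: "S > 0" using S Suc.prems by (cases S) (auto simp: field_simps)
    have "\<forall>\<^sub>F n in sequentially. avg n (\<lambda>t. ip (T (P (t + s)) w) (T (P (t + s')) w)) \<le> e\<^sup>2 / 8"
      if "s \<noteq> s'" for s s'
    proof -
      let ?z = "int s - int s'"
      have z: "?z \<noteq> 0" using that by simp
      have "lead D (of_int ?z * C) (\<lambda>t. P (t + s) - P (t + s'))"
        using P that by simp
      moreover have "\<forall>\<^sub>F n in sequentially. nrm (avg n (\<lambda>t. T (of_nat t * (of_int z * (of_int ?z * C))) w)) \<le> \<kappa>"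
        if "z \<noteq> 0" for z :: int
        using *[rule_format, of "z * ?z"] that z by (simp add: mult.assoc)
      ultimately have "\<forall>\<^sub>F n in sequentially. nrm (avg n (\<lambda>t. T (P (t + s) - P (t + s')) w)) \<le> e\<^sup>2 / 16"
        using \<kappa>(2) w unfolding weyl_const_def by blast
      then show ?thesis
      proof eventually_elim
        case (elim n)
        have "avg n (\<lambda>t. ip (T (P (t + s)) w) (T (P (t + s')) w))
            = ip w (avg n (\<lambda>t. T (P (t + s) - P (t + s')) w))"
          by (simp add: ip_T_diff ip_avg_right)
        also have "\<dots> \<le> nrm w * nrm (avg n (\<lambda>t. T (P (t + s) - P (t + s')) w))"
          using abs_ip_le by (rule abs_le_D1)
        also have "\<dots> \<le> 2 * (e\<^sup>2 / 16)"
          using w elim by (intro mult_mono) auto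
        finally show ?case by simp
      qed
    qed
    then have "\<forall>\<^sub>F n in sequentially. nrm (avg n (\<lambda>t. T (P t) w)) \<le> e / 2 + sqrt (2\<^sup>2 / real S + e\<^sup>2 / 8)"
      using w Suc.prems Spos by (intro van_der_corput) (auto simp: nrm_T)
    moreover have "sqrt (2\<^sup>2 / real S + e\<^sup>2 / 8) \<le> e / 2"
    proof (rule real_le_lsqrt)
      have "4 / real S \<le> e\<^sup>2 / 8" using S Spos Suc.prems by (simp add: field_simps)
      then show "2\<^sup>2 / real S + e\<^sup>2 / 8 \<le> (e / 2)\<^sup>2" by (simp add: power_divide)
    qed (use Suc.prems in auto)
    ultimately show "\<forall>\<^sub>F n in sequentially. nrm (avg n (\<lambda>t. T (P t) w)) \<le> e"
      by (auto elim!: eventually_mono)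
  qed
  then show ?case using \<kappa>(1) by blast
qed

text \<open>The lattices \<open>lat l p i\<close>, for \<open>i\<close> running down from \<open>degree p + 1\<close> to \<open>1\<close>, form the chain along
  which the vector \<open>f\<close> is decomposed; \<open>stage\<close> treats one step, where only the coefficients of degree
  at most \<open>i\<close> still act.\<close>

definition lat :: "nat \<Rightarrow> 'g poly \<Rightarrow> nat \<Rightarrow> 'g set" where
  "lat l p i = {\<Sum>j=i..degree p. of_int (int l * c j) * coeff p j | c. True}"

lemma latI: "g = (\<Sum>j=i..degree p. of_int (int l * c j) * coeff p j) \<Longrightarrow> g \<in> lat l p i"
  by (auto simp: lat_def)

lemma addclosed_lat: "addclosed (lat l p i)"
  unfolding addclosed_def
proof (intro conjI ballI)
  show "0 \<in> lat l p i" by (rule latI[where c="\<lambda>_. 0"]) simp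
  fix x y assume "x \<in> lat l p i" "y \<in> lat l p i"
  then obtain c c' where "x = (\<Sum>j=i..degree p. of_int (int l * c j) * coeff p j)"
    "y = (\<Sum>j=i..degree p. of_int (int l * c' j) * coeff p j)"
    unfolding lat_def by blast
  then show "x + y \<in> lat l p i"
    by (intro latI[where c="\<lambda>j. c j + c' j"]) (simp add: sum.distrib distrib_left distrib_right)
qed

lemma zero_in_lat: "0 \<in> lat l p i"
  using addclosed_lat unfolding addclosed_def by blast

lemma lat_Suc_subset: "lat l p (Suc i) \<subseteq> lat l p i"
proof
  fix g assume "g \<in> lat l p (Suc i)"
  then obtain c where g: "g = (\<Sum>j=Suc i..degree p. of_int (int l * c j) * coeff p j)"
    unfolding lat_def by blast
  show "g \<in> lat l p i"
  proof (rule latI[where c="\<lambda>j. if j = i then 0 else c j"])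
    have "(\<Sum>j=i..degree p. of_int (int l * (if j = i then 0 else c j)) * coeff p j)
      = (\<Sum>j=Suc i..degree p. of_int (int l * (if j = i then 0 else c j)) * coeff p j)"
      by (rule sum.mono_neutral_right) auto
    also have "\<dots> = g" unfolding g by (rule sum.cong) auto
    finally show "g = (\<Sum>j=i..degree p. of_int (int l * (if j = i then 0 else c j)) * coeff p j)" ..
  qed
qed

lemma lat_mult_subset: "lat (l * l') p i \<subseteq> lat l p i"
proof
  fix g assume "g \<in> lat (l * l') p i"
  then obtain c where "g = (\<Sum>j=i..degree p. of_int (int (l * l') * c j) * coeff p j)"
    unfolding lat_def by blast
  then show "g \<in> lat l p i"
    by (intro latI[where c="\<lambda>j. int l' * c j"]) (simp add: mult.assoc)
qed

text \<open>Along a residue class modulo \<open>l\<close>, the part of \<open>p\<close> of degree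
  above \<open>i\<close> changes only by elements of \<open>lat l p (Suc i)\<close>, which almost
  fix both \<open>u\<close> and \<open>v\<close>. A polynomial sequence of degree at most
  \<open>i\<close> remains, controlled by \<open>weyl_const\<close>; the linear averages it asks
  about are small by \<open>nrm_linear_avg_diff_le\<close> and \<open>stable\<close>.\<close>

lemma stage:
  assumes i: "1 \<le> i" "i \<le> degree p" and l: "l > 0" and e: "0 < e" "e \<le> 1"
    and stable: "\<And>l'. l' > 0 \<Longrightarrow> minsq (lat (l * l') p i) \<le> minsq (lat l p i) + e"
    and u: "near (lat l p (Suc i)) e u" and v: "near (lat l p i) e v"
    and weyl: "weyl_const (i - 1) \<eta> \<kappa>" "sqrt (48 * sqrt e) \<le> \<kappa>" "\<eta> \<ge> 0"
  shows "\<forall>\<^sub>F n in sequentially.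
    nrm (avg (l * n) (\<lambda>t. T (poly p (of_nat t)) (u - v))) \<le> \<eta> + 4 * sqrt e"
proof -
  define r where "r = degree p"
  \<comment> \<open>\<open>R \<rho>\<close> freezes the part of degree above \<open>i\<close> at
    \<open>\<rho>\<close>, \<open>q0\<close> is the part of degree at most \<open>i\<close>, and
    \<open>q \<rho>\<close> is \<open>q0\<close> at \<open>\<rho> + l X\<close> plus that
    constant.\<close>
  define R where "R = (\<lambda>\<rho>::nat. \<Sum>j=Suc i..r. coeff p j * of_nat \<rho> ^ j)"
  define q0 where "q0 = (\<Sum>j\<le>i. monom (coeff p j) j)"
  define q where "q = (\<lambda>\<rho>::nat. pcompose q0 [:of_nat \<rho>, of_nat l:] + [:R \<rho>:])"
  define C where "C = of_nat (fact i) * (of_nat l ^ i * coeff p i)"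
  obtain i' where i': "i = Suc i'" using i by (cases i) auto
  have deg_q0: "degree q0 \<le> i"
    unfolding q0_def by (intro degree_sum_le) (auto intro: order_trans[OF degree_monom_le])
  have coeff_q0: "coeff q0 i = coeff p i"
    unfolding q0_def by (simp add: coeff_sum)
  have poly_p: "poly p x = poly q0 x + (\<Sum>j=Suc i..r. coeff p j * x ^ j)" for x
  proof -
    have "poly p x = (\<Sum>j\<le>r. coeff p j * x ^ j)"
      unfolding r_def by (rule poly_altdef)
    also have "{..r} = {..i} \<union> {Suc i..r}" using i unfolding r_def by auto
    also have "(\<Sum>j\<in>\<dots>. coeff p j * x ^ j) = (\<Sum>j\<le>i. coeff p j * x ^ j) + (\<Sum>j=Suc i..r. coeff p j * x ^ j)"
      by (rule sum.union_disjoint) auto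
    finally show ?thesis by (simp add: q0_def poly_sum poly_monom)
  qed
  have deg_q: "degree (q \<rho>) \<le> i" for \<rho>
    unfolding q_def using deg_q0 degree_pcompose_le[of q0 "[:of_nat \<rho>, of_nat l:]"]
    by (intro degree_add_le) (auto intro: order_trans)
  have coeff_q: "coeff (q \<rho>) i = of_nat l ^ i * coeff p i" for \<rho>
    unfolding q_def using deg_q0 i' coeff_q0
    by (simp add: coeff_pcompose_linear coeff_eq_0)
  have lead: "lead (i - 1) C (\<lambda>t. poly (q \<rho>) (of_nat t))" for \<rho>
    using lead_poly[of "q \<rho>" i'] deg_q[of \<rho>] coeff_q[of \<rho>] unfolding C_def i' by simp
  have small: "\<forall>\<^sub>F n in sequentially. nrm (avg n (\<lambda>t. T (of_nat t * (of_int z * C)) (u - v))) \<le> \<kappa>"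
    if z: "z \<noteq> 0" for z :: int
  proof -
    \<comment> \<open>With this factor, every degree \<open>i\<close> term of
      \<open>lat (l * l') p i\<close> is an integer multiple of \<open>of_int z * C\<close>, while
      the higher terms stay in \<open>lat l p (Suc i)\<close>.\<close>
    define l' where "l' = fact i * l ^ i * nat \<bar>z\<bar>"
    have l': "l' > 0" using l z unfolding l'_def by simp
    have "\<forall>\<^sub>F n in sequentially. nrm (avg n (\<lambda>t. T (of_nat t * (of_int z * C)) (u - v))) \<le> sqrt (48 * sqrt e)"
    proof (rule nrm_linear_avg_diff_le[OF addclosed_lat u zero_in_lat _ addclosed_lat v lat_Suc_subset])
      show "minsq (lat (l * l') p i) \<le> minsq (lat l p i) + e" using stable[OF l'] .
      show "0 < e" "e \<le> 1" by fact+
    next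
      fix g assume "g \<in> lat (l * l') p i"
      then obtain c where "g = (\<Sum>j=i..r. of_int (int (l * l') * c j) * coeff p j)"
        unfolding lat_def r_def by blast
      also have "\<dots> = of_int (int (l * l') * c i) * coeff p i + (\<Sum>j=Suc i..r. of_int (int (l * l') * c j) * coeff p j)"
        using i unfolding r_def by (subst sum.atLeast_Suc_atMost) auto
      also have "of_int (int (l * l') * c i) * coeff p i = of_int (int l * c i * sgn z) * (of_int z * C)"
      proof -
        have "int l' = sgn z * z * (int (fact i) * int l ^ i)"
          unfolding l'_def by (simp add: sgn_if)
        then have "int (l * l') * c i = (int l * c i * sgn z) * (z * (int (fact i) * int l ^ i))"
          by (simp only: of_nat_mult ac_simps)
        then show ?thesis
          by (simp only: C_def of_int_mult of_int_power of_int_of_nat_eq mult.assoc)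
      qed
      also have "(\<Sum>j=Suc i..r. of_int (int (l * l') * c j) * coeff p j) =
          (\<Sum>j=Suc i..r. of_int (int l * (int l' * c j)) * coeff p j)" by (simp add: mult.assoc)
      finally have gA: "g = (\<Sum>j=Suc i..r. of_int (int l * (int l' * c j)) * coeff p j) + of_int (int l * c i * sgn z) * (of_int z * C)"
        by (simp add: add.commute)
      have gB: "(\<Sum>j=Suc i..r. of_int (int l * (int l' * c j)) * coeff p j) \<in> lat l p (Suc i)"
        by (rule latI[where c="\<lambda>j. int l' * c j"]) (simp add: r_def)
      show "\<exists>h\<in>lat l p (Suc i). \<exists>s::int. g = h + of_int s * (of_int z * C)"
        by (rule bexI[OF _ gB], rule exI, rule gA)
    next
      fix t :: nat
      \<comment> \<open>One of the \<open>i\<close> factors \<open>l\<close> in \<open>C\<close> is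
        left to supply the factor demanded by \<open>lat\<close>; hence the exponent
        \<open>i'\<close>, and \<open>i \<ge> 1\<close> is essential here.\<close>
      define c where "c = (\<lambda>j. if j = i then int t * z * int (fact i) * int l ^ i' else 0)"
      have "(\<Sum>j=i..r. of_int (int l * c j) * coeff p j) = (\<Sum>j\<in>{i}. of_int (int l * c j) * coeff p j)"
        using i unfolding r_def c_def by (intro sum.mono_neutral_right) auto
      also have "\<dots> = of_nat t * (of_int z * C)"
      proof -
        have "int l ^ i = int l * int l ^ i'" by (simp add: i')
        then have "int l * c i = int t * (z * (int (fact i) * int l ^ i))"
          unfolding c_def by (simp only: simp_thms if_True ac_simps)
        then have "of_int (int l * c i) * coeff p i = of_nat t * (of_int z * C)"
          by (simp only: C_def of_int_mult of_int_power of_int_of_nat_eq mult.assoc)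
        then show ?thesis by simp
      qed
      finally show "of_nat t * (of_int z * C) \<in> lat l p i"
        by (intro latI[where c=c]) (simp add: r_def)
    qed
    then show ?thesis using weyl(2) by (auto elim!: eventually_mono)
  qed
  have "u \<in> Orb (lat l p (Suc i))" "v \<in> Orb (lat l p i)"
    using u v by (simp_all add: near_def)
  then have norm_w: "nrm (u - v) \<le> 2"
    using nrm_diff[of u v] nrm_Orb[of u "lat l p (Suc i)"] nrm_Orb[of v "lat l p i"] by linarith
  have "\<forall>\<^sub>F n in sequentially. nrm (avg n (\<lambda>t. T (poly (q \<rho>) (of_nat t)) (u - v))) \<le> \<eta>" for \<rho>
    by (rule weyl_constD[OF weyl(1) lead norm_w]) (rule small)
  then have "\<forall>\<^sub>F n in sequentially. \<forall>\<rho>\<in>{..<l}. nrm (avg n (\<lambda>t. T (poly (q \<rho>) (of_nat t)) (u - v))) \<le> \<eta>"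
    by (intro eventually_ball_finite) auto
  then show ?thesis
  proof eventually_elim
    case (elim n)
    have "nrm (avg n (\<lambda>t. T (poly p (of_nat (l * t + \<rho>))) (u - v))) \<le> \<eta> + 4 * sqrt e" if "\<rho> < l" for \<rho>
    proof -
      have "nrm (T (poly p (of_nat (l * t + \<rho>))) (u - v) - T (poly (q \<rho>) (of_nat t)) (u - v)) \<le> 4 * sqrt e" for t
      proof -
        \<comment> \<open>The division is exact because \<open>l t + \<rho>\<close> and
          \<open>\<rho>\<close> have congruent powers modulo \<open>l\<close>.\<close>
        define c where "c = (\<lambda>j. ((int l * int t + int \<rho>) ^ j - int \<rho> ^ j) div int l)"
        have c: "int l * c j = (int l * int t + int \<rho>) ^ j - int \<rho> ^ j" for j
        proof -
          have "(int l * int t + int \<rho>) - int \<rho> dvd (int l * int t + int \<rho>) ^ j - int \<rho> ^ j"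
            by (subst power_diff_sumr2) (rule dvd_triv_left)
          then have "int l dvd (int l * int t + int \<rho>) ^ j - int \<rho> ^ j"
            by (simp add: dvd_mult_left)
          then show ?thesis unfolding c_def by simp
        qed
        define g where "g = (\<Sum>j=Suc i..r. of_int (int l * c j) * coeff p j)"
        have g: "g \<in> lat l p (Suc i)" unfolding g_def r_def by (rule latI) simp
        then have g': "g \<in> lat l p i" using lat_Suc_subset by blast
        have "g = (\<Sum>j=Suc i..r. coeff p j * of_nat (l * t + \<rho>) ^ j) - R \<rho>"
          unfolding g_def c R_def by (simp add: sum_subtractf algebra_simps)
        then have "poly p (of_nat (l * t + \<rho>)) = poly (q \<rho>) (of_nat t) + g"
          by (simp add: poly_p q_def poly_pcompose algebra_simps)
        then have "T (poly p (of_nat (l * t + \<rho>))) (u - v) - T (poly (q \<rho>) (of_nat t)) (u - v)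
            = T (poly (q \<rho>) (of_nat t)) ((T g u - u) - (T g v - v))"
          by (simp add: T_plus T_diff)
        also have "nrm \<dots> \<le> nrm (T g u - u) + nrm (T g v - v)"
          unfolding nrm_T by (rule nrm_diff)
        also have "\<dots> \<le> 2 * sqrt e + 2 * sqrt e"
          by (intro add_mono near_invariant[OF addclosed_lat g u] near_invariant[OF addclosed_lat g' v])
        finally show ?thesis by simp
      qed
      then have "nrm (avg n (\<lambda>t. T (poly p (of_nat (l * t + \<rho>))) (u - v) - T (poly (q \<rho>) (of_nat t)) (u - v))) \<le> 4 * sqrt e"
        using e by (intro nrm_avg_le) auto
      moreover have "nrm (avg n (\<lambda>t. T (poly (q \<rho>) (of_nat t)) (u - v))) \<le> \<eta>"
        using elim that by simp
      ultimately show ?thesis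
        using nrm_add[of "avg n (\<lambda>t. T (poly p (of_nat (l * t + \<rho>))) (u - v)) - avg n (\<lambda>t. T (poly (q \<rho>) (of_nat t)) (u - v))"
          "avg n (\<lambda>t. T (poly (q \<rho>) (of_nat t)) (u - v))"]
        unfolding avg_diff diff_add_cancel by linarith
    qed
    then show "nrm (avg (l * n) (\<lambda>t. T (poly p (of_nat t)) (u - v))) \<le> \<eta> + 4 * sqrt e"
      unfolding avg_residue_classes[OF l] using weyl(3) e by (rule_tac nrm_avg_le) simp_all
  qed
qed

section \<open>Positive correlation at some value of a polynomial\<close>

lemma T_of_nat_mult_cong:
  assumes "T g = T h"
  shows "T (of_nat n * g) = T (of_nat n * h)"
proof (induction n)
  case (Suc n)
  have "T (of_nat (Suc n) * g) u = T (of_nat (Suc n) * h) u" for u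
    using Suc assms by (simp add: distrib_right T_plus)
  then show ?case by blast
qed simp

text \<open>Moving \<open>T g\<close> to the other side, almost invariance of \<open>u\<close> gives
  nearly the same inner product with every translate of \<open>f\<close>. The resulting bound is
  preserved by convex combinations, and \<open>u\<close> is in the hull.\<close>

lemma ip_near_ge:
  assumes "near (range ((*) (of_nat k))) e u"
  shows "ip u u \<le> ip f u + 2 * sqrt e"
proof -
  have ac: "addclosed (range ((*) (of_nat k :: 'g)))"
    unfolding addclosed_def by (auto simp: image_iff) (metis mult_zero_right, metis distrib_left)
  have "convex {v. ip v u \<le> ip f u + 2 * sqrt e}"
  proof (rule convexI)
    fix v w a b
    assume "v \<in> {v. ip v u \<le> ip f u + 2 * sqrt e}" "w \<in> {v. ip v u \<le> ip f u + 2 * sqrt e}"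
      "0 \<le> (a::real)" "0 \<le> b" "a + b = 1"
    then show "a *\<^sub>R v + b *\<^sub>R w \<in> {v. ip v u \<le> ip f u + 2 * sqrt e}"
      by (simp add: ip_add_left ip_scale_left convex_bound_le)
  qed
  moreover have "ip (T g f) u \<le> ip f u + 2 * sqrt e" if g: "g \<in> range ((*) (of_nat k))" for g
  proof -
    have mg: "- g \<in> range ((*) (of_nat k))" using g by (auto simp: image_iff) (metis mult_minus_right)
    have "ip (T g f) (T g (T (- g) u)) = ip f (T (- g) u)" by (rule ip_T)
    then have "ip (T g f) u = ip f (T (- g) u)" by (simp add: T_plus[symmetric] T_zero)
    also have "\<dots> = ip f u + ip f (T (- g) u - u)" by (simp add: ip_diff_right)
    also have "ip f (T (- g) u - u) \<le> nrm f * nrm (T (- g) u - u)"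
      using abs_ip_le by (rule abs_le_D1)
    also have "\<dots> \<le> 1 * (2 * sqrt e)"
      using nrm_f_le near_invariant[OF ac mg assms] by (intro mult_mono) auto
    finally show ?thesis by simp
  qed
  ultimately show ?thesis
    using assms unfolding near_def by (elim conjE Orb_induct[where P="\<lambda>v. ip v u \<le> ip f u + 2 * sqrt e"]) auto
qed

text \<open>The first condition on \<open>p\<close> keeps its values in \<open>k\<close> times the
  group, the second says that its nonconstant coefficients generate some nonzero multiple of the
  group. Both are read through \<open>T\<close>, which may identify distinct group elements.\<close>

theorem polynomial_recurrence:
  assumes \<delta>: "\<delta> > 0" and low: "\<And>u. u \<in> Orb UNIV \<Longrightarrow> \<delta> \<le> ip u u"
  shows "\<exists>k>0. \<forall>p. (\<forall>t::nat. \<exists>x. T (poly p (of_nat t)) = T (of_nat k * x)) \<longrightarrow>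
    (\<exists>l'>0. \<forall>x. \<exists>c::nat \<Rightarrow> int. T (of_nat l' * x) = T (\<Sum>j=1..degree p. of_int (c j) * coeff p j)) \<longrightarrow>
    (\<exists>t::nat. ip f (T (poly p (of_nat t)) f) > 0)"
proof -
  define G where "G = (\<lambda>k::nat. range ((*) (of_nat k :: 'g)))"
  have ac: "addclosed (G k)" for k
    unfolding addclosed_def G_def by (auto simp: image_iff) (metis mult_zero_right, metis distrib_left)
  have G0: "0 \<in> G k" for k using ac unfolding addclosed_def by blast
  have Gmult: "G (k * k') \<subseteq> G k" for k k'
    unfolding G_def by (auto simp: mult.assoc)
  \<comment> \<open>With \<open>sqrt e0 = \<delta> / 28\<close> the final estimate leaves
    \<open>(\<delta> - 2 * sqrt e0) - (\<delta> / 4 + 5 * sqrt e0) = \<delta> / 2\<close>.\<close>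
  define e0 where "e0 = (\<delta> / 28)\<^sup>2"
  have e0: "e0 > 0" "sqrt e0 = \<delta> / 28" using \<delta> unfolding e0_def by auto
  obtain k where k: "k > 0" "\<And>k'. k' > 0 \<Longrightarrow> minsq (G (k * k')) \<le> minsq (G k) + e0"
    using stable_multiple[of "\<lambda>i k. minsq (G k)" 1 e0 1] e0(1)
      minsq_antimono[OF Gmult G0] minsq_le_1[OF G0] by auto
  obtain uk where uk: "near (G k) e0 uk" using near_exists[OF G0 e0(1)] by blast
  have uk_low: "ip f uk \<ge> \<delta> - 2 * sqrt e0"
    using ip_near_ge[of k e0 uk] low[of uk] uk Orb_mono[of "G k" UNIV] unfolding near_def G_def by fastforce
  show ?thesis
  proof (rule exI[of _ k], intro conjI allI impI k(1))
    fix p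
    assume val: "\<forall>t::nat. \<exists>x. T (poly p (of_nat t)) = T (of_nat k * x)"
    assume "\<exists>l'>0. \<forall>x. \<exists>c::nat \<Rightarrow> int. T (of_nat l' * x) = T (\<Sum>j=1..degree p. of_int (c j) * coeff p j)"
    then obtain l' where l': "l' > 0"
      "\<And>x. \<exists>c::nat \<Rightarrow> int. T (of_nat l' * x) = T (\<Sum>j=1..degree p. of_int (c j) * coeff p j)" by blast
    define r where "r = degree p"
    \<comment> \<open>Each of the \<open>r\<close> stages will cost at most
      \<open>2 * \<eta>\<close>, in total at most \<open>\<delta> / 4\<close>.\<close>
    define \<eta> where "\<eta> = \<delta> / (8 * (real r + 1))"
    have \<eta>: "\<eta> > 0" using \<delta> unfolding \<eta>_def by simp
    have "\<forall>i. \<exists>\<kappa>>0. weyl_const (i - 1) \<eta> \<kappa>"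
      using weyl_const_exists[OF \<eta>] by blast
    then obtain \<kappa> :: "nat \<Rightarrow> real" where \<kappa>: "\<And>i. \<kappa> i > 0" "\<And>i. weyl_const (i - 1) \<eta> (\<kappa> i)"
      by metis
    define \<kappa>0 where "\<kappa>0 = Min (insert 1 (\<kappa> ` {1..r}))"
    have \<kappa>0: "\<kappa>0 > 0" "\<And>i. i \<in> {1..r} \<Longrightarrow> \<kappa>0 \<le> \<kappa> i"
      using \<kappa>(1) by (simp add: \<kappa>0_def, unfold \<kappa>0_def, intro Min_le, auto)
    \<comment> \<open>The last two entries give \<open>sqrt (48 * sqrt e) \<le> \<kappa>0\<close>
      and \<open>4 * sqrt e \<le> \<eta>\<close>, as \<open>stage\<close> requires.\<close>
    define e where "e = Min {e0, 1, (\<kappa>0\<^sup>2 / 48)\<^sup>2, (\<eta> / 4)\<^sup>2}"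
    have e: "0 < e" "e \<le> e0" "e \<le> 1" "e \<le> (\<kappa>0\<^sup>2 / 48)\<^sup>2" "e \<le> (\<eta> / 4)\<^sup>2"
      using e0 \<kappa>0 \<eta> unfolding e_def by auto
    have e\<eta>: "4 * sqrt e \<le> \<eta>"
      using real_sqrt_le_mono[OF e(5)] \<eta> by simp
    have "sqrt e \<le> \<kappa>0\<^sup>2 / 48"
      using real_sqrt_le_mono[OF e(4)] by simp
    then have e\<kappa>: "sqrt (48 * sqrt e) \<le> \<kappa>0"
      using \<kappa>0(1) by (intro real_le_lsqrt) auto
    obtain l where l: "l > 0" "k dvd l"
      "\<And>i m. i < Suc r \<Longrightarrow> m > 0 \<Longrightarrow> minsq (lat (l * m) p i) \<le> minsq (lat l p i) + e"
      using stable_multiple[of "\<lambda>i l. minsq (lat l p i)" k e "Suc r"] k(1) e(1)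
        minsq_antimono[OF lat_mult_subset zero_in_lat] minsq_le_1[OF zero_in_lat] by auto
    obtain u where u: "\<And>i. near (lat l p i) e (u i)"
      using near_exists[OF zero_in_lat e(1)] by metis
    \<comment> \<open>The chain starts at \<open>f\<close>: above the degree the lattice is trivial
      and its orbit hull is a single point.\<close>
    have u_top: "u (Suc r) = f"
    proof -
      have "lat l p (Suc r) = {0}" unfolding lat_def r_def by auto
      then show ?thesis using u[of "Suc r"] unfolding near_def Orb_def by (simp add: T_zero)
    qed
    have "lat l p 1 \<subseteq> G k"
    proof
      fix g assume "g \<in> lat l p 1"
      then obtain c where g: "g = (\<Sum>j=1..degree p. of_int (int l * c j) * coeff p j)"
        unfolding lat_def by blast
      obtain b where b: "l = k * b" using l(2) by auto
      have "g = of_nat k * (\<Sum>j=1..degree p. of_int (int b * c j) * coeff p j)"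
        unfolding g b by (simp add: sum_distrib_left mult.assoc)
      then show "g \<in> G k" unfolding G_def by blast
    qed
    \<comment> \<open>As far as the orbit of \<open>f\<close> is concerned, \<open>lat l p 1\<close>
      is squeezed between \<open>G (k * (l * l'))\<close> and \<open>G k\<close>. The choice of
      \<open>k\<close> makes their minima differ by at most \<open>e0\<close>, so \<open>u 1\<close>
      is almost minimal for \<open>G k\<close> as well.\<close>
    moreover have "minsq (lat l p 1) \<le> minsq (G (k * (l * l')))"
    proof (rule minsq_antimono_Orb[OF _ G0])
      have "(\<lambda>g. T g f) ` G (k * (l * l')) \<subseteq> (\<lambda>g. T g f) ` lat l p 1"
      proof
        fix y assume "y \<in> (\<lambda>g. T g f) ` G (k * (l * l'))"
        then obtain x where x: "y = T (of_nat (k * (l * l')) * x) f" unfolding G_def by blast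
        obtain c where c: "T (of_nat l' * (of_nat k * x)) = T (\<Sum>j=1..degree p. of_int (c j) * coeff p j)"
          using l'(2) by blast
        have "y = T (of_nat l * (of_nat l' * (of_nat k * x))) f"
          unfolding x by (simp add: algebra_simps)
        also have "\<dots> = T (of_nat l * (\<Sum>j=1..degree p. of_int (c j) * coeff p j)) f"
          using T_of_nat_mult_cong[OF c] by metis
        finally have "y = T (of_nat l * (\<Sum>j=1..degree p. of_int (c j) * coeff p j)) f" .
        moreover have "of_nat l * (\<Sum>j=1..degree p. of_int (c j) * coeff p j) \<in> lat l p 1"
          by (rule latI[where c=c]) (simp add: sum_distrib_left mult.assoc)
        ultimately show "y \<in> (\<lambda>g. T g f) ` lat l p 1" by blast
      qed
      then show "Orb (G (k * (l * l'))) \<subseteq> Orb (lat l p 1)"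
        unfolding Orb_def by (rule hull_mono)
    qed
    moreover have "minsq (G (k * (l * l'))) \<le> minsq (G k) + e0"
      using k(2) l(1) l'(1) by simp
    ultimately have "near (G k) (2 * e0) (u 1)"
      using u[of 1] e(2) Orb_mono[of "lat l p 1" "G k"] unfolding near_def by auto
    from near_unique[OF this uk] have "nrm (u 1 - uk) \<le> sqrt (6 * e0)" by simp
    also have "\<dots> \<le> 3 * sqrt e0"
      using e0(1) real_sqrt_le_mono[of "6 * e0" "9 * e0"] real_sqrt_mult[of 9 e0] by simp
    finally have u1: "nrm (u 1 - uk) \<le> 3 * sqrt e0" .
    have "\<forall>\<^sub>F n in sequentially. nrm (avg (l * n) (\<lambda>t. T (poly p (of_nat t)) (u (Suc i) - u i))) \<le> \<eta> + 4 * sqrt e"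
      if "i \<in> {1..r}" for i
      using that l e u \<kappa>(2) \<eta> order_trans[OF e\<kappa> \<kappa>0(2)[OF that]]
      by (intro stage[where \<kappa>="\<kappa> i"]) (auto simp: r_def)
    then have "\<forall>\<^sub>F n in sequentially. \<forall>i\<in>{1..r}.
        nrm (avg (l * n) (\<lambda>t. T (poly p (of_nat t)) (u (Suc i) - u i))) \<le> \<eta> + 4 * sqrt e"
      by (intro eventually_ball_finite) auto
    moreover have "\<forall>\<^sub>F n in sequentially. n > (0::nat)"
      by (rule eventually_gt_at_top)
    ultimately have "\<forall>\<^sub>F n in sequentially. (\<forall>i\<in>{1..r}.
        nrm (avg (l * n) (\<lambda>t. T (poly p (of_nat t)) (u (Suc i) - u i))) \<le> \<eta> + 4 * sqrt e) \<and> n > 0"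
      by (rule eventually_conj)
    then obtain n where n: "\<And>i. i \<in> {1..r} \<Longrightarrow>
        nrm (avg (l * n) (\<lambda>t. T (poly p (of_nat t)) (u (Suc i) - u i))) \<le> \<eta> + 4 * sqrt e" "n > 0"
      unfolding eventually_sequentially by blast
    define N where "N = l * n"
    have N: "N > 0" using l(1) n(2) unfolding N_def by simp
    define A where "A = (\<lambda>v. avg N (\<lambda>t. T (poly p (of_nat t)) v))"
    have A_diff: "A (v - w) = A v - A w" for v w
      by (simp add: A_def T_diff avg_diff)
    have A_le: "nrm (A v) \<le> nrm v" for v
      unfolding A_def by (intro nrm_avg_le) (auto simp: nrm_T)
    \<comment> \<open>Telescoping down the chain from \<open>u (Suc r) = f\<close>; each difference
      is one application of \<open>stage\<close>.\<close>
    have "A f - A (u 1) = (\<Sum>i=1..r. A (u (Suc i)) - A (u i))"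
      using sum_Suc_diff[of 1 r "\<lambda>i. A (u i)"] u_top by simp
    also have "nrm \<dots> \<le> (\<Sum>i=1..r. 2 * \<eta>)"
      using n(1) e\<eta> by (intro order_trans[OF nrm_sum] sum_mono)
        (fastforce simp: A_def N_def T_diff avg_diff)
    also have "\<dots> \<le> \<delta> / 4"
      using \<delta> unfolding \<eta>_def by (simp add: field_simps)
    finally have 1: "nrm (A f - A (u 1)) \<le> \<delta> / 4" .
    have 2: "nrm (A (u 1) - A uk) \<le> 3 * sqrt e0"
      using A_le[of "u 1 - uk"] u1 unfolding A_diff by simp
    have "nrm (avg N (\<lambda>t. T (poly p (of_nat t)) uk - uk)) \<le> 2 * sqrt e0"
    proof (rule nrm_avg_le)
      fix t
      obtain x where "T (poly p (of_nat t)) = T (of_nat k * x)" using val by blast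
      moreover have "of_nat k * x \<in> G k" unfolding G_def by blast
      ultimately show "nrm (T (poly p (of_nat t)) uk - uk) \<le> 2 * sqrt e0"
        using near_invariant[OF ac _ uk] by simp
    qed (use e0 in auto)
    then have 3: "nrm (A uk - uk) \<le> 2 * sqrt e0"
      using N by (simp add: A_def avg_diff avg_const)
    have "nrm (A f - uk) \<le> \<delta> / 4 + 5 * sqrt e0"
      using 1 2 3 nrm_diff_triangle[of "A f" "A uk" "A (u 1)"] nrm_diff_triangle[of "A f" uk "A uk"] by linarith
    then have "\<bar>ip f (A f - uk)\<bar> \<le> 1 * (\<delta> / 4 + 5 * sqrt e0)"
      using nrm_f_le by (intro order_trans[OF abs_ip_le] mult_mono) auto
    then have "ip f (A f) > 0"
      using uk_low e0(2) \<delta> abs_le_D2[of "ip f (A f - uk)"] unfolding ip_diff_right by fastforce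
    then have "avg N (\<lambda>t. ip f (T (poly p (of_nat t)) f)) > 0"
      by (simp add: A_def ip_avg_right)
    then have "\<not> (\<Sum>t<N. ip f (T (poly p (of_nat t)) f)) \<le> 0"
      using N by (simp add: avg_def zero_less_divide_iff)
    then show "\<exists>t. ip f (T (poly p (of_nat t)) f) > 0"
      by (meson not_le sum_nonpos)
  qed
qed

end

section \<open>Invariant means and density\<close>

typedef 'a bfun = "{u :: 'a \<Rightarrow> real. \<exists>K. \<forall>x. \<bar>u x\<bar> \<le> K}"
  morphisms bapply Bfun
  by (intro exI[of _ "\<lambda>_. 0"]) auto

setup_lifting type_definition_bfun

instantiation bfun :: (type) real_vector
begin

lift_definition zero_bfun :: "'a bfun" is "\<lambda>_. 0" by auto

lift_definition plus_bfun :: "'a bfun \<Rightarrow> 'a bfun \<Rightarrow> 'a bfun" is "\<lambda>u v x. u x + v x"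
proof -
  fix u v :: "'a \<Rightarrow> real"
  assume "\<exists>K. \<forall>x. \<bar>u x\<bar> \<le> K" "\<exists>K. \<forall>x. \<bar>v x\<bar> \<le> K"
  then obtain K K' where "\<And>x. \<bar>u x\<bar> \<le> K" "\<And>x. \<bar>v x\<bar> \<le> K'" by blast
  then show "\<exists>K. \<forall>x. \<bar>u x + v x\<bar> \<le> K"
    by (intro exI[of _ "K + K'"]) (meson abs_triangle_ineq add_mono order_trans)
qed

lift_definition uminus_bfun :: "'a bfun \<Rightarrow> 'a bfun" is "\<lambda>u x. - u x" by simp

lift_definition minus_bfun :: "'a bfun \<Rightarrow> 'a bfun \<Rightarrow> 'a bfun" is "\<lambda>u v x. u x - v x"
proof -
  fix u v :: "'a \<Rightarrow> real"
  assume "\<exists>K. \<forall>x. \<bar>u x\<bar> \<le> K" "\<exists>K. \<forall>x. \<bar>v x\<bar> \<le> K"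
  then obtain K K' where "\<And>x. \<bar>u x\<bar> \<le> K" "\<And>x. \<bar>v x\<bar> \<le> K'" by blast
  then show "\<exists>K. \<forall>x. \<bar>u x - v x\<bar> \<le> K"
    by (intro exI[of _ "K + K'"]) (meson abs_triangle_ineq4 add_mono order_trans)
qed

lift_definition scaleR_bfun :: "real \<Rightarrow> 'a bfun \<Rightarrow> 'a bfun" is "\<lambda>c u x. c * u x"
proof -
  fix c :: real and u :: "'a \<Rightarrow> real"
  assume "\<exists>K. \<forall>x. \<bar>u x\<bar> \<le> K"
  then obtain K where "\<And>x. \<bar>u x\<bar> \<le> K" by blast
  then show "\<exists>K. \<forall>x. \<bar>c * u x\<bar> \<le> K"
    by (intro exI[of _ "\<bar>c\<bar> * K"]) (auto simp: abs_mult intro: mult_left_mono)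
qed

instance
  by standard (transfer; simp add: algebra_simps fun_eq_iff)+

end

lift_definition bmult :: "'a bfun \<Rightarrow> 'a bfun \<Rightarrow> 'a bfun" is "\<lambda>u v x. u x * v x"
proof -
  fix u v :: "'a \<Rightarrow> real"
  assume "\<exists>K. \<forall>x. \<bar>u x\<bar> \<le> K" "\<exists>K. \<forall>x. \<bar>v x\<bar> \<le> K"
  then obtain K K' where "\<And>x. \<bar>u x\<bar> \<le> K" "\<And>x. \<bar>v x\<bar> \<le> K'" by blast
  then show "\<exists>K. \<forall>x. \<bar>u x * v x\<bar> \<le> K"
    by (intro exI[of _ "K * K'"]) (auto simp: abs_mult intro!: mult_mono intro: order_trans[OF abs_ge_zero])
qed

lift_definition btranslate :: "'a::plus \<Rightarrow> 'a bfun \<Rightarrow> 'a bfun" is "\<lambda>g u x. u (x + g)"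
  by blast

lift_definition bindicator :: "'a set \<Rightarrow> 'a bfun" is "\<lambda>A x. indicator A x"
  by (intro exI[of _ 1]) (auto simp: indicator_def)

section \<open>Means over finite sets and their limits along filters\<close>

definition mean :: "'a set \<Rightarrow> 'a bfun \<Rightarrow> real" where
  "mean M u = (\<Sum>x\<in>M. bapply u x) / real (card M)"

lemma bapply_bounded: "\<exists>K. \<forall>x. \<bar>bapply u x\<bar> \<le> K"
  by transfer

lemma mean_add: "mean M (u + v) = mean M u + mean M v"
  by (simp add: mean_def plus_bfun.rep_eq sum.distrib add_divide_distrib)

lemma mean_scale: "mean M (c *\<^sub>R u) = c * mean M u"
  by (simp add: mean_def scaleR_bfun.rep_eq sum_distrib_left)

lemma abs_mean_le:
  assumes "\<And>x. \<bar>bapply u x\<bar> \<le> K" "K \<ge> 0"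
  shows "\<bar>mean M u\<bar> \<le> K"
proof -
  have "\<bar>\<Sum>x\<in>M. bapply u x\<bar> \<le> real (card M) * K"
    using sum_bounded_above[of M "\<lambda>x. \<bar>bapply u x\<bar>" K] assms(1) sum_abs[of "bapply u" M]
    by (auto intro: order_trans)
  then show ?thesis
    using assms(2) unfolding mean_def by (cases "card M = 0") (auto simp: field_simps)
qed

text \<open>Only the two one-sided differences of \<open>M\<close> and its translate contribute.
  They have equal size because the two sets do, hence the factor 2.\<close>

lemma abs_mean_translate_le:
  fixes g :: "'g::ab_group_add"
  assumes "finite M" "\<And>x. \<bar>bapply u x\<bar> \<le> K"
  shows "\<bar>mean M (btranslate g u) - mean M u\<bar> \<le> 2 * K * (card ((\<lambda>x. x + g) ` M - M) / card M)"
proof -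
  let ?N = "(\<lambda>x. x + g) ` M"
  have fin: "finite ?N" using assms(1) by simp
  have card_N: "card ?N = card M" by (rule card_image) (simp add: inj_on_def)
  have card_eq: "card (M - ?N) = card (?N - M)"
    using card_Un_Int[OF assms(1) fin] card_N
    by (simp add: card_Diff_subset_Int assms(1) fin Int_commute)
  have bound: "\<bar>sum (bapply u) Z\<bar> \<le> real (card Z) * K" for Z
    using sum_bounded_above[of Z "\<lambda>x. \<bar>bapply u x\<bar>" K] assms(2) sum_abs[of "bapply u" Z]
    by (auto intro: order_trans)
  have "(\<Sum>x\<in>M. bapply (btranslate g u) x) = sum (bapply u) ?N"
    by (subst sum.reindex) (auto simp: inj_on_def btranslate.rep_eq)
  also have "\<dots> = sum (bapply u) (?N - M) + sum (bapply u) (?N \<inter> M)"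
    using sum.Int_Diff[OF fin, of "bapply u" M] by simp
  finally have "(\<Sum>x\<in>M. bapply (btranslate g u) x) - (\<Sum>x\<in>M. bapply u x)
      = sum (bapply u) (?N - M) - sum (bapply u) (M - ?N)"
    using sum.Int_Diff[OF assms(1), of "bapply u" ?N] by (simp add: Int_commute)
  then have "\<bar>(\<Sum>x\<in>M. bapply (btranslate g u) x) - (\<Sum>x\<in>M. bapply u x)\<bar> \<le> 2 * K * card (?N - M)"
    using bound[of "?N - M"] bound[of "M - ?N"] card_eq by (simp add: mult.commute abs_diff_le_iff) linarith
  then show ?thesis
    unfolding mean_def by (simp add: divide_right_mono flip: diff_divide_distrib)
qed

text \<open>The means of each \<open>u\<close> stay in a compact interval, so by Tychonoff the
  families of all means have a cluster point \<open>L\<close>. Refining \<open>F0\<close> by the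
  pullback of its neighbourhoods makes the means of all \<open>u\<close> converge at once.\<close>

lemma mean_limit_exists:
  fixes M :: "nat \<Rightarrow> 'a set"
  assumes "F0 \<noteq> bot"
  obtains F and L :: "'a bfun \<Rightarrow> real"
    where "F \<noteq> bot" "F \<le> F0" "\<And>u. ((\<lambda>n. mean (M n) u) \<longlongrightarrow> L u) F"
proof -
  obtain K :: "'a bfun \<Rightarrow> real" where K: "\<And>u x. \<bar>bapply u x\<bar> \<le> K u"
    using bapply_bounded by metis
  define \<Phi> where "\<Phi> = (\<lambda>n u. mean (M n) u)"
  define X where "X = PiE (UNIV :: 'a bfun set) (\<lambda>u. {- K u..K u})"
  have "compactin (product_topology (\<lambda>_. euclidean) UNIV) X"
    unfolding X_def compactin_PiE by auto
  then have "compact X"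
    by (simp add: euclidean_product_topology)
  moreover have "\<Phi> n \<in> X" for n
  proof -
    have "\<bar>mean (M n) u\<bar> \<le> K u" for u
      by (rule abs_mean_le) (use K order_trans[OF abs_ge_zero K] in auto)
    then show ?thesis unfolding X_def \<Phi>_def by (auto simp: abs_le_iff) (smt (verit))
  qed
  ultimately obtain L where L: "inf (nhds L) (filtermap \<Phi> F0) \<noteq> bot"
    using assms unfolding compact_filter
    by (metis (mono_tags, lifting) eventually_filtermap eventuallyI filtermap_bot_iff)
  define F where "F = inf F0 (filtercomap \<Phi> (nhds L))"
  have "F \<noteq> bot"
  proof
    assume "F = bot"
    then have "eventually (\<lambda>_. False) F" by simp
    then obtain P Q where PQ: "eventually P F0" "eventually Q (filtercomap \<Phi> (nhds L))" "\<And>n. P n \<Longrightarrow> Q n \<Longrightarrow> False"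
      unfolding F_def eventually_inf by blast
    obtain R where R: "eventually R (nhds L)" "\<And>n. R (\<Phi> n) \<Longrightarrow> Q n"
      using PQ(2) unfolding eventually_filtercomap by blast
    have "eventually (\<lambda>y. \<not> R y) (filtermap \<Phi> F0)"
      unfolding eventually_filtermap using PQ(1) by eventually_elim (use PQ(3) R(2) in blast)
    then have "eventually (\<lambda>_. False) (inf (nhds L) (filtermap \<Phi> F0))"
      using R(1) unfolding eventually_inf by blast
    then show False using L by (simp add: trivial_limit_def)
  qed
  moreover have "F \<le> F0" unfolding F_def by simp
  moreover have "((\<lambda>n. mean (M n) u) \<longlongrightarrow> L u) F" for u
  proof -
    have "filterlim \<Phi> (nhds L) F"
      unfolding F_def by (rule filterlim_mono[OF filterlim_filtercomap]) auto
    then have "((\<lambda>n. \<Phi> n u) \<longlongrightarrow> L u) F"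
      using continuous_on_tendsto_compose[OF continuous_on_product_coordinates, of \<Phi> L F u] by simp
    then show ?thesis unfolding \<Phi>_def .
  qed
  ultimately show thesis using that by blast
qed

text \<open>The group acts by translation through the homomorphism \<open>\<pi>\<close>, which in
  the application discards the positions without meaning. The Folner condition makes the limiting
  mean invariant, so the action is orthogonal.\<close>

theorem density_polynomial_recurrence:
  fixes M :: "nat \<Rightarrow> 'g::comm_ring_1 set" and \<pi> :: "'g \<Rightarrow> 'g" and A :: "'g set"
  assumes M: "\<And>n. finite (M n)" "\<And>n. M n \<noteq> {}"
    and \<pi>: "\<And>g h. \<pi> (g + h) = \<pi> g + \<pi> h"
    and folner: "\<And>g. (\<lambda>n. card ((\<lambda>x. x + \<pi> g) ` M n - M n) / card (M n)) \<longlonglongrightarrow> 0"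
    and c: "c > 0" "\<exists>\<^sub>F n in sequentially. card (A \<inter> M n) / card (M n) > c"
  shows "\<exists>k>0. \<forall>p. (\<forall>t::nat. \<exists>x. \<pi> (poly p (of_nat t)) = \<pi> (of_nat k * x)) \<longrightarrow>
    (\<exists>l'>0. \<forall>x. \<exists>c::nat \<Rightarrow> int. \<pi> (of_nat l' * x) = \<pi> (\<Sum>j=1..degree p. of_int (c j) * coeff p j)) \<longrightarrow>
    (\<exists>t::nat. \<exists>c>0. \<exists>\<^sub>F n in sequentially.
       card {x \<in> M n. x \<in> A \<and> x + \<pi> (poly p (of_nat t)) \<in> A} / card (M n) > c)"
proof -
  \<comment> \<open>Restricting to the \<open>n\<close> with density above \<open>c\<close> turns
    upper density into a lower bound for the limiting mean of the indicator.\<close>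
  define F0 where "F0 = inf sequentially (principal {n. card (A \<inter> M n) / card (M n) > c})"
  have "F0 \<noteq> bot"
    using c(2) unfolding F0_def trivial_limit_def eventually_inf_principal frequently_def by simp
  then obtain F L where F: "F \<noteq> bot" "F \<le> F0" "\<And>u. ((\<lambda>n. mean (M n) u) \<longlongrightarrow> L u) F"
    using mean_limit_exists[of F0 M] by blast
  have F_seq: "F \<le> sequentially" using F(2) unfolding F0_def by simp
  have L_unique: "L u = l" if "((\<lambda>n. mean (M n) u) \<longlongrightarrow> l) F" for u l
    using tendsto_unique[OF F(1) F(3) that] .
  have L_add: "L (u + v) = L u + L v" for u v
    by (rule L_unique) (simp add: mean_add tendsto_add F(3))
  have L_scale: "L (a *\<^sub>R u) = a * L u" for a u
    by (rule L_unique) (simp add: mean_scale tendsto_mult_left F(3))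
  have L_nonneg: "0 \<le> L u" if "\<And>x. 0 \<le> bapply u x" for u
    by (rule tendsto_lowerbound[OF F(3) _ F(1)]) (auto simp: mean_def that sum_nonneg)
  have L_translate: "L (btranslate (\<pi> g) u) = L u" for g u
  proof (rule L_unique)
    obtain K where K: "\<And>x. \<bar>bapply u x\<bar> \<le> K" using bapply_bounded by blast
    have "(\<lambda>n. mean (M n) (btranslate (\<pi> g) u) - mean (M n) u) \<longlonglongrightarrow> 0"
    proof (rule metric_tendsto_imp_tendsto)
      show "\<forall>\<^sub>F n in sequentially. dist (mean (M n) (btranslate (\<pi> g) u) - mean (M n) u) 0
        \<le> dist (2 * K * (card ((\<lambda>x. x + \<pi> g) ` M n - M n) / card (M n))) 0"
        using order_trans[OF abs_mean_translate_le[OF M(1) K] abs_ge_self] by (simp add: dist_real_def)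
      show "(\<lambda>n. 2 * K * (card ((\<lambda>x. x + \<pi> g) ` M n - M n) / card (M n))) \<longlonglongrightarrow> 0"
        using tendsto_mult_left[OF folner[of g], of "2 * K"] by simp
    qed
    then have "((\<lambda>n. mean (M n) (btranslate (\<pi> g) u) - mean (M n) u) \<longlongrightarrow> 0) F"
      using F_seq by (rule filterlim_mono[OF _ order_refl])
    from tendsto_add[OF this F(3)[of u]]
    show "((\<lambda>n. mean (M n) (btranslate (\<pi> g) u)) \<longlongrightarrow> L u) F" by simp
  qed
  define ip where "ip = (\<lambda>u v. L (bmult u v))"
  define T where "T = (\<lambda>g. btranslate (\<pi> g))"
  define f where "f = bindicator A"
  have \<pi>0: "\<pi> 0 = 0" using \<pi>[of 0 0] by simp
  have mean_le: "mean (M n) u \<le> 1" if "\<And>x. bapply u x \<le> 1" for u n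
    using sum_bounded_above[of "M n" "bapply u" 1] that M by (simp add: mean_def divide_le_eq card_gt_0_iff)
  interpret orthogonal_action ip T f
  proof
    fix u v w :: "'g bfun" and a :: real and g h :: 'g
    show "ip u v = ip v u"
      unfolding ip_def by (rule arg_cong[of _ _ L], transfer) (simp add: mult.commute)
    have "bmult (u + v) w = bmult u w + bmult v w"
      by transfer (simp add: distrib_right)
    then show "ip (u + v) w = ip u w + ip v w" by (simp add: ip_def L_add)
    have "bmult (a *\<^sub>R u) v = a *\<^sub>R bmult u v"
      by transfer (simp add: mult.assoc)
    then show "ip (a *\<^sub>R u) v = a * ip u v" by (simp add: ip_def L_scale)
    show "0 \<le> ip u u" unfolding ip_def by (rule L_nonneg) (simp add: bmult.rep_eq)
    show "T g (u + v) = T g u + T g v" unfolding T_def by transfer simp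
    show "T g (a *\<^sub>R u) = a *\<^sub>R T g u" unfolding T_def by transfer simp
    show "T (g + h) u = T g (T h u)"
      unfolding T_def \<pi> by transfer (simp add: add.assoc)
    show "T 0 u = u" unfolding T_def \<pi>0 by transfer simp
    have "bmult (T g u) (T g v) = T g (bmult u v)" unfolding T_def by transfer simp
    then show "ip (T g u) (T g v) = ip u v" by (simp add: ip_def T_def L_translate)
    have "L (bmult f f) \<le> 1"
      by (rule tendsto_upperbound[OF F(3) _ F(1)]) (auto intro!: always_eventually mean_le simp: bmult.rep_eq f_def bindicator.rep_eq indicator_def)
    then show "ip f f \<le> 1" by (simp add: ip_def)
  qed
  have Lf: "L f \<ge> c"
  proof (rule tendsto_lowerbound[OF F(3) _ F(1)])
    have "\<forall>\<^sub>F n in F0. c \<le> mean (M n) f"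
      unfolding F0_def eventually_inf_principal using M(1)
      by (auto simp: mean_def f_def bindicator.rep_eq indicator_def sum.If_cases Int_commute Int_def conj_commute
          intro!: always_eventually)
    then show "\<forall>\<^sub>F n in F. c \<le> mean (M n) f" using F(2) by (rule filter_leD[rotated])
  qed
  \<comment> \<open>Invariance makes \<open>L\<close> constant on the orbit hull; Cauchy-Schwarz
    against the constant function 1 does the rest.\<close>
  have low: "c\<^sup>2 \<le> ip u u" if "u \<in> Orb UNIV" for u
  proof -
    define one where "one = (bindicator UNIV :: 'g bfun)"
    have "L u = L f"
    proof (rule Orb_induct[OF that])
      show "convex {u. L u = L f}"
        by (rule convexI) (simp add: L_add L_scale flip: distrib_right)
      show "L (T g f) = L f" for g by (simp add: T_def L_translate)
    qed
    have "bmult u one = u" unfolding one_def by transfer simp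
    then have "ip u one = L u" by (simp add: ip_def)
    moreover have "ip one one = 1"
    proof -
      have "bmult one one = one" unfolding one_def by transfer simp
      moreover have "L one = 1"
        by (rule L_unique) (use M in \<open>simp add: mean_def one_def bindicator.rep_eq card_eq_0_iff\<close>)
      ultimately show ?thesis by (simp add: ip_def)
    qed
    ultimately have "(L u)\<^sup>2 \<le> ip u u" using ip_cauchy_schwarz[of u one] by simp
    moreover have "c\<^sup>2 \<le> (L u)\<^sup>2" using Lf \<open>L u = L f\<close> c(1) by (intro power_mono) auto
    ultimately show ?thesis by simp
  qed
  obtain k where k: "k > 0" "\<And>p. (\<forall>t::nat. \<exists>x. T (poly p (of_nat t)) = T (of_nat k * x)) \<Longrightarrow>
    (\<exists>l'>0. \<forall>x. \<exists>c::nat \<Rightarrow> int. T (of_nat l' * x) = T (\<Sum>j=1..degree p. of_int (c j) * coeff p j)) \<Longrightarrow>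
    (\<exists>t::nat. ip f (T (poly p (of_nat t)) f) > 0)"
    using polynomial_recurrence[OF _ low] c(1) by auto
  show ?thesis
  proof (rule exI[of _ k], intro conjI k(1) allI impI)
    fix p
    assume *: "\<forall>t::nat. \<exists>x. \<pi> (poly p (of_nat t)) = \<pi> (of_nat k * x)"
      "\<exists>l'>0. \<forall>x. \<exists>c::nat \<Rightarrow> int. \<pi> (of_nat l' * x) = \<pi> (\<Sum>j=1..degree p. of_int (c j) * coeff p j)"
    have "\<exists>t::nat. ip f (T (poly p (of_nat t)) f) > 0"
      by (rule k(2)) (use * in \<open>unfold T_def, metis+\<close>)
    then obtain t :: nat where t: "L (bmult f (btranslate (\<pi> (poly p (of_nat t))) f)) > 0" (is "L ?h > 0")
      unfolding ip_def T_def by blast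
    have "\<forall>\<^sub>F n in F. mean (M n) ?h > L ?h / 2"
      using t by (intro order_tendstoD(1)[OF F(3)]) simp
    then have "\<exists>\<^sub>F n in F. mean (M n) ?h > L ?h / 2"
      using F(1) by (rule eventually_frequently[rotated])
    then have "\<exists>\<^sub>F n in sequentially. mean (M n) ?h > L ?h / 2"
      unfolding frequently_def using F_seq by (auto dest: filter_leD)
    moreover have "mean (M n) ?h = card {x \<in> M n. x \<in> A \<and> x + \<pi> (poly p (of_nat t)) \<in> A} / card (M n)" for n
    proof -
      have "bapply ?h x = indicator {x. x \<in> A \<and> x + \<pi> (poly p (of_nat t)) \<in> A} x" for x
        by (simp add: bmult.rep_eq btranslate.rep_eq f_def bindicator.rep_eq indicator_def)
      moreover have "M n \<inter> {x. x \<in> A \<and> x + \<pi> (poly p (of_nat t)) \<in> A} =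
          {x \<in> M n. x \<in> A \<and> x + \<pi> (poly p (of_nat t)) \<in> A}" by auto
      ultimately show ?thesis using M(1) by (simp add: mean_def indicator_def sum.If_cases)
    qed
    ultimately show "\<exists>t::nat. \<exists>c>0. \<exists>\<^sub>F n in sequentially.
       card {x \<in> M n. x \<in> A \<and> x + \<pi> (poly p (of_nat t)) \<in> A} / card (M n) > c"
      using t by (intro exI[of _ t] exI[of _ "L ?h / 2"]) auto
  qed
qed

section \<open>Polynomial curves in a conjugacy class\<close>

lemma of_int_fun_apply: "(of_int n :: 'a \<Rightarrow> 'b::ring_1) x = of_int n"
  by (cases n rule: int_diff_cases) (simp add: of_nat_fun)

lemma sum_fun_apply: "(\<Sum>i\<in>I. f i) x = (\<Sum>i\<in>I. f i x :: 'b::comm_monoid_add)"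
  by (induction I rule: infinite_finite_induct) auto

text \<open>Evaluation is at natural numbers because an additive map commutes with multiplication by
  these.\<close>

lemma poly_map_poly_additive:
  fixes \<Phi> :: "'a::comm_ring_1 \<Rightarrow> 'a"
  assumes "\<And>x y. \<Phi> (x + y) = \<Phi> x + \<Phi> y" "\<And>n x. \<Phi> (of_nat n * x) = of_nat n * \<Phi> x"
  shows "poly (map_poly \<Phi> p) (of_nat t) = \<Phi> (poly p (of_nat t))"
proof -
  have 0: "\<Phi> 0 = 0" using assms(2)[of 0 0] by simp
  show ?thesis
    by (induction p) (simp_all add: 0 assms map_poly_pCons)
qed

text \<open>Matrices are handled through all functions \<open>nat \<times> nat \<Rightarrow> int\<close>, whose pointwise ring structure
  provides the integer multiples and the polynomials used above. Positions outside the \<open>d \<times> d\<close>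
  square carry no meaning.\<close>

type_synonym entries = "nat \<times> nat \<Rightarrow> int"

section \<open>Conjugation by elementary matrices\<close>

definition conj_orbit :: "nat \<Rightarrow> int mat \<Rightarrow> int mat set" where
  "conj_orbit d A = {g * A * h | g h. g \<in> SL d \<and> h \<in> carrier_mat d d \<and> g * h = 1\<^sub>m d \<and> h * g = 1\<^sub>m d}"

text \<open>The linear and (up to sign) the quadratic coefficient in \<open>s\<close> of
  \<open>(1 + s E\<^sub>k\<^sub>l) X (1 - s E\<^sub>k\<^sub>l)\<close>.\<close>
definition conj_lin :: "nat \<Rightarrow> nat \<Rightarrow> entries \<Rightarrow> entries" where
  "conj_lin k l X = (\<lambda>(i, j). (if i = k then X (l, j) else 0) - (if j = l then X (i, k) else 0))"

definition conj_quad :: "nat \<Rightarrow> nat \<Rightarrow> entries \<Rightarrow> entries" where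
  "conj_quad k l X = (\<lambda>(i, j). if i = k \<and> j = l then X (l, k) else 0)"

lemma conj_orbit_carrier: "A \<in> carrier_mat d d \<Longrightarrow> X \<in> conj_orbit d A \<Longrightarrow> X \<in> carrier_mat d d"
  unfolding conj_orbit_def SL_def by auto

lemma self_in_conj_orbit: "A \<in> carrier_mat d d \<Longrightarrow> A \<in> conj_orbit d A"
  unfolding conj_orbit_def SL_def by (auto intro!: exI[of _ "1\<^sub>m d"])

text \<open>If \<open>X = g * A * h\<close>, conjugating by an elementary matrix replaces the pair
  by \<open>?P * g\<close> and \<open>h * ?Q\<close>. The entries follow by reading the conjugation
  as one column and one row operation.\<close>

lemma conj_orbit_elementary:
  assumes A: "A \<in> carrier_mat d d" and X: "X \<in> conj_orbit d A" and kl: "k < d" "l < d" "k \<noteq> l"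
  shows "\<exists>Y\<in>conj_orbit d A. \<forall>i<d. \<forall>j<d. Y $$ (i, j) =
    X $$ (i, j) + s * conj_lin k l (($$) X) (i, j) - s\<^sup>2 * conj_quad k l (($$) X) (i, j)"
proof -
  obtain g h where gh: "X = g * A * h" "g \<in> carrier_mat d d" "det g = 1" "h \<in> carrier_mat d d"
    "g * h = 1\<^sub>m d" "h * g = 1\<^sub>m d"
    using X unfolding conj_orbit_def SL_def by auto
  have Xc: "X \<in> carrier_mat d d" using conj_orbit_carrier[OF A X] .
  let ?P = "addrow_mat d s k l" and ?Q = "addrow_mat d (- s) k l"
  have PQ: "?P * ?Q = 1\<^sub>m d" "?Q * ?P = 1\<^sub>m d"
    using addrow_mat_inv[OF kl, of s] addrow_mat_inv[OF kl, of "- s"] by simp_all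
  have P: "?P \<in> carrier_mat d d" and Q: "?Q \<in> carrier_mat d d" by simp_all
  define Y where "Y = add_col_sub_row (- s) k l X"
  have "X * ?Q = addcol (- s) l k X"
    using addcol_mat[OF Xc kl(1), of "- s" l] by simp
  moreover have "?P * addcol (- s) l k X = addrow s k l (addcol (- s) l k X)"
    by (rule addrow_mat[symmetric, OF _ kl(2), of _ d]) (use Xc in auto)
  ultimately have "Y = ?P * (X * ?Q)"
    unfolding Y_def add_col_sub_row_def by simp
  also have "\<dots> = (?P * g) * A * (h * ?Q)"
    unfolding gh(1) using P Q gh A by (simp add: assoc_mult_mat[of _ d d _ d _ d])
  finally have Y: "Y = (?P * g) * A * (h * ?Q)" .
  have "det (?P * g) = 1"
    using det_mult[OF P gh(2)] det_addrow_mat[OF kl(3), of d s] gh(3) by simp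
  moreover have "(?P * g) * (h * ?Q) = 1\<^sub>m d"
  proof -
    have "g * (h * ?Q) = ?Q"
      using assoc_mult_mat[OF gh(2,4) Q] gh(5) Q by simp
    then show ?thesis
      using assoc_mult_mat[OF P gh(2), of "h * ?Q" d] gh(4) Q PQ(1) by simp
  qed
  moreover have "(h * ?Q) * (?P * g) = 1\<^sub>m d"
  proof -
    have "?Q * (?P * g) = g"
      using assoc_mult_mat[OF Q P gh(2)] PQ(2) gh(2) by simp
    then show ?thesis
      using assoc_mult_mat[OF gh(4) Q, of "?P * g" d] P gh(2,6) by simp
  qed
  ultimately have "Y \<in> conj_orbit d A"
    unfolding conj_orbit_def SL_def using P Q gh(2,4) Y
    by (intro CollectI exI[of _ "?P * g"] exI[of _ "h * ?Q"] conjI) auto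
  moreover have "\<forall>i<d. \<forall>j<d. Y $$ (i, j) =
    X $$ (i, j) + s * conj_lin k l (($$) X) (i, j) - s\<^sup>2 * conj_quad k l (($$) X) (i, j)"
    using Xc kl unfolding Y_def by (auto simp: conj_lin_def conj_quad_def power2_eq_square algebra_simps)
  ultimately show ?thesis by blast
qed

section \<open>Polynomial curves of conjugates and the spans of their coefficients\<close>

definition conj_path :: "nat \<Rightarrow> int mat \<Rightarrow> entries poly \<Rightarrow> bool" where
  "conj_path d A p \<longleftrightarrow> (\<forall>i<d. \<forall>j<d. coeff p 0 (i, j) = A $$ (i, j)) \<and>
     (\<forall>t::nat. \<exists>X\<in>conj_orbit d A. \<forall>i<d. \<forall>j<d. X $$ (i, j) = poly p (of_nat t) (i, j))"

text \<open>The integer points of the rational span of the coefficients of degree at least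
  \<open>a\<close>, with \<open>r\<close> a common denominator. The free bound \<open>N\<close>
  spares tracking degrees.\<close>

definition coeff_span :: "nat \<Rightarrow> nat \<Rightarrow> entries poly \<Rightarrow> entries set" where
  "coeff_span a d p = {X. \<exists>r>0::nat. \<exists>N. \<exists>c::nat \<Rightarrow> int. \<forall>i<d. \<forall>j<d.
     int r * X (i, j) = (\<Sum>m=a..N. c m * coeff p m (i, j))}"

lemma coeff_spanI:
  assumes "(r::nat) > 0" "\<And>i j. i < d \<Longrightarrow> j < d \<Longrightarrow> int r * X (i, j) = (\<Sum>m=a..N. c m * coeff p m (i, j))"
  shows "X \<in> coeff_span a d p"
  unfolding coeff_span_def using assms
  by (intro CollectI exI[of _ r] conjI exI[of _ N] exI[of _ c]) auto

lemma coeff_span_degree: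
  assumes "X \<in> coeff_span a d p"
  shows "\<exists>r>0::nat. \<exists>c::nat \<Rightarrow> int. \<forall>i<d. \<forall>j<d.
    int r * X (i, j) = (\<Sum>m=a..degree p. c m * coeff p m (i, j))"
proof -
  obtain r :: nat and N and c :: "nat \<Rightarrow> int" where r: "r > 0"
    "\<And>i j. i < d \<Longrightarrow> j < d \<Longrightarrow> int r * X (i, j) = (\<Sum>m=a..N. c m * coeff p m (i, j))"
    using assms unfolding coeff_span_def by blast
  define c' where "c' = (\<lambda>m. if m \<le> N then c m else 0)"
  have "(\<Sum>m=a..N. c m * coeff p m x) = (\<Sum>m=a..degree p. c' m * coeff p m x)" for x
  proof -
    have "(\<Sum>m=a..N. c m * coeff p m x) = (\<Sum>m=a..max N (degree p). c' m * coeff p m x)"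
      by (rule sum.mono_neutral_cong_left) (auto simp: c'_def)
    also have "\<dots> = (\<Sum>m=a..degree p. c' m * coeff p m x)"
      by (rule sum.mono_neutral_right) (auto simp: coeff_eq_0)
    finally show ?thesis .
  qed
  then show ?thesis using r by (intro exI[of _ r] conjI exI[of _ c']) auto
qed

lemma coeff_span_scale_cancel:
  assumes "(\<lambda>x. n * X x) \<in> coeff_span a d p" "n \<noteq> 0"
  shows "X \<in> coeff_span a d p"
proof -
  obtain r :: nat and c :: "nat \<Rightarrow> int" where r: "r > 0"
    "\<And>i j. i < d \<Longrightarrow> j < d \<Longrightarrow> int r * (n * X (i, j)) = (\<Sum>m=a..degree p. c m * coeff p m (i, j))"
    using coeff_span_degree[OF assms(1)] by blast
  have "int (r * nat \<bar>n\<bar>) * X (i, j) = (\<Sum>m=a..degree p. (sgn n * c m) * coeff p m (i, j))" if "i < d" "j < d" for i j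
  proof -
    have "int (r * nat \<bar>n\<bar>) * X (i, j) = sgn n * (int r * (n * X (i, j)))"
      by (simp add: sgn_if)
    then show ?thesis using r(2)[OF that] by (simp add: sum_distrib_left mult.assoc)
  qed
  moreover have "r * nat \<bar>n\<bar> > 0" using r(1) assms(2) by simp
  ultimately show ?thesis by (intro coeff_spanI)
qed

lemma coeff_span_cong:
  assumes "X \<in> coeff_span a d p" "\<And>i j. i < d \<Longrightarrow> j < d \<Longrightarrow> X (i, j) = Y (i, j)"
  shows "Y \<in> coeff_span a d p"
  using assms unfolding coeff_span_def by auto

lemma coeff_span_1_subset: "coeff_span 1 d p \<subseteq> coeff_span 0 d p"
proof
  fix X assume "X \<in> coeff_span 1 d p"
  from coeff_span_degree[OF this] obtain r :: nat and c :: "nat \<Rightarrow> int" where r: "r > 0"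
    "\<And>i j. i < d \<Longrightarrow> j < d \<Longrightarrow> int r * X (i, j) = (\<Sum>m=1..degree p. c m * coeff p m (i, j))"
    by blast
  have "(\<Sum>m=1..degree p. c m * coeff p m x) = (\<Sum>m=0..degree p. (if m = 0 then 0 else c m) * coeff p m x)" for x
    by (rule sum.mono_neutral_cong_left) auto
  then show "X \<in> coeff_span 0 d p"
    using r(2) by (intro coeff_spanI[OF r(1)]) auto
qed

lemma conj_path_self_in_span:
  assumes "conj_path d A p"
  shows "(\<lambda>x. A $$ x) \<in> coeff_span 0 d p"
  unfolding coeff_span_def using assms
  by (intro CollectI exI[of _ "1::nat"] conjI exI[of _ "0::nat"] exI[of _ "\<lambda>_. 1"]) (auto simp: conj_path_def)

lemma conj_path_exists: "A \<in> carrier_mat d d \<Longrightarrow> conj_path d A [:\<lambda>x. A $$ x:]"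
  unfolding conj_path_def using self_in_conj_orbit[of A d] by (auto intro!: bexI[of _ A])

text \<open>Conjugating by \<open>1 + t^K E\<^sub>k\<^sub>l\<close> with \<open>K\<close> larger than the degree keeps the old coefficients and
  appends their images under \<open>conj_lin\<close> and \<open>conj_quad\<close> in separate degrees.\<close>

lemma conj_path_step:
  assumes A: "A \<in> carrier_mat d d" and p: "conj_path d A p" and kl: "k < d" "l < d" "k \<noteq> l"
  obtains q where "conj_path d A q" "coeff_span 1 d p \<subseteq> coeff_span 1 d q"
    "\<And>X. X \<in> coeff_span 0 d p \<Longrightarrow> conj_lin k l X \<in> coeff_span 1 d q"
    "\<And>X. X \<in> coeff_span 0 d p \<Longrightarrow> conj_quad k l X \<in> coeff_span 1 d q"
proof -
  define K where "K = Suc (degree p)"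
  let ?L = "conj_lin k l" and ?Q = "conj_quad k l"
  have add: "?L (X + Y) = ?L X + ?L Y" "?Q (X + Y) = ?Q X + ?Q Y" for X Y
    by (auto simp: conj_lin_def conj_quad_def fun_eq_iff)
  have scale: "?L (of_nat n * X) = of_nat n * ?L X" "?Q (of_nat n * X) = of_nat n * ?Q X" for n X
    by (auto simp: conj_lin_def conj_quad_def fun_eq_iff algebra_simps)
  have zero: "?L 0 = 0" "?Q 0 = 0"
    by (auto simp: conj_lin_def conj_quad_def fun_eq_iff)
  \<comment> \<open>Since \<open>degree p < K\<close>, the blocks of degrees below \<open>K\<close>,
    from \<open>K\<close> to \<open>2K - 1\<close>, and from \<open>2K\<close> on do not mix. The
    constant coefficient \<open>A\<close> counts only for \<open>coeff_span 0\<close>, but its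
    images land in positive degree.\<close>
  define q where "q = p + monom 1 K * map_poly ?L p - monom 1 (2 * K) * map_poly ?Q p"
  have c1: "coeff q m = coeff p m" if "m < K" for m
    using that by (simp add: q_def coeff_monom_mult)
  have c2: "coeff q (K + m) = ?L (coeff p m)" if "m < K" for m
    using that by (simp add: q_def coeff_monom_mult coeff_eq_0 K_def coeff_map_poly zero)
  have c3: "coeff q (2 * K + m) = - ?Q (coeff p m)" for m
    by (simp add: q_def coeff_monom_mult coeff_eq_0 K_def coeff_map_poly zero)
  show thesis
  proof
    show "conj_path d A q" unfolding conj_path_def
    proof (intro conjI allI impI)
      fix i j assume "i < d" "j < d"
      then show "coeff q 0 (i, j) = A $$ (i, j)"
        using c1[of 0] p by (simp add: K_def conj_path_def)
    next
      fix t :: nat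
      have "\<exists>X\<in>conj_orbit d A. \<forall>i<d. \<forall>j<d. X $$ (i, j) = poly p (of_nat t) (i, j)"
        using p unfolding conj_path_def by (elim conjE) (erule spec)
      then obtain X where X: "X \<in> conj_orbit d A"
          "\<forall>i<d. \<forall>j<d. X $$ (i, j) = poly p (of_nat t) (i, j)"
        by (rule bexE)
      define s where "s = int t ^ K"
      obtain Y where Y: "Y \<in> conj_orbit d A" "\<And>i j. i < d \<Longrightarrow> j < d \<Longrightarrow> Y $$ (i, j) =
        X $$ (i, j) + s * ?L (($$) X) (i, j) - s\<^sup>2 * ?Q (($$) X) (i, j)"
        using conj_orbit_elementary[OF A X(1) kl, of s] by blast
      have s: "(of_nat t :: entries) ^ K = of_nat (t ^ K)" "(of_nat t :: entries) ^ (2 * K) = of_nat ((t ^ K)\<^sup>2)"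
        by (simp_all add: power_mult mult.commute[of 2 K])
      have "poly q (of_nat t) = poly p (of_nat t) + of_nat (t ^ K) * ?L (poly p (of_nat t))
          - of_nat ((t ^ K)\<^sup>2) * ?Q (poly p (of_nat t))"
        unfolding q_def poly_diff poly_add poly_mult poly_monom mult_1 s
        by (simp only: poly_map_poly_additive[of ?L, OF add(1) scale(1)] poly_map_poly_additive[of ?Q, OF add(2) scale(2)])
      then have "poly q (of_nat t) x = poly p (of_nat t) x + s * ?L (poly p (of_nat t)) x
          - s\<^sup>2 * ?Q (poly p (of_nat t)) x" for x
        by (simp add: s_def del: of_nat_power) simp
      moreover have "?L (($$) X) (i, j) = ?L (poly p (of_nat t)) (i, j)"
        "?Q (($$) X) (i, j) = ?Q (poly p (of_nat t)) (i, j)" if "i < d" "j < d" for i j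
        using that kl X(2)[rule_format, of l j] X(2)[rule_format, of i k] X(2)[rule_format, of l k]
        by (simp_all add: conj_lin_def conj_quad_def)
      ultimately show "\<exists>X\<in>conj_orbit d A. \<forall>i<d. \<forall>j<d. X $$ (i, j) = poly q (of_nat t) (i, j)"
        using Y X(2) by (intro bexI[of _ Y]) auto
    qed
  next
    show "coeff_span 1 d p \<subseteq> coeff_span 1 d q"
    proof
      fix X assume "X \<in> coeff_span 1 d p"
      from coeff_span_degree[OF this] obtain r :: nat and c :: "nat \<Rightarrow> int" where r: "r > 0"
        "\<And>i j. i < d \<Longrightarrow> j < d \<Longrightarrow> int r * X (i, j) = (\<Sum>m=1..degree p. c m * coeff p m (i, j))"
        by blast
      have "(\<Sum>m=1..degree p. c m * coeff p m x) = (\<Sum>m=1..degree p. c m * coeff q m x)" for x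
        by (rule sum.cong) (auto simp: c1 K_def)
      then show "X \<in> coeff_span 1 d q"
        using r(2) by (intro coeff_spanI[OF r(1)]) auto
    qed
  next
    fix X assume "X \<in> coeff_span 0 d p"
    from coeff_span_degree[OF this] obtain r :: nat and c :: "nat \<Rightarrow> int" where r: "r > 0"
      "\<And>i j. i < d \<Longrightarrow> j < d \<Longrightarrow> int r * X (i, j) = (\<Sum>m=0..degree p. c m * coeff p m (i, j))"
      by blast
    have shift: "(\<Sum>m=0..degree p. c m * b m) = (\<Sum>m=1..B+degree p. (if m < B then 0 else c (m - B)) * b (m - B))"
      if "B \<ge> 1" for B and b :: "nat \<Rightarrow> int"
    proof -
      have "(\<Sum>m=0..degree p. c m * b m) = (\<Sum>m=0+B..degree p+B. c (m - B) * b (m - B))"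
        by (subst sum.shift_bounds_cl_nat_ivl) simp
      also have "\<dots> = (\<Sum>m=1..B+degree p. (if m < B then 0 else c (m - B)) * b (m - B))"
        using that by (intro sum.mono_neutral_cong_left) auto
      finally show ?thesis .
    qed
    have "int r * ?L X (i, j) = (\<Sum>m=1..K+degree p. (if m < K then 0 else c (m - K)) * coeff q m (i, j))"
      if "i < d" "j < d" for i j
    proof -
      have "int r * ?L X (i, j) = (\<Sum>m=0..degree p. c m * ?L (coeff p m) (i, j))"
        using that kl r(2) by (auto simp: conj_lin_def right_diff_distrib sum_subtractf sum_negf if_distrib cong: if_cong)
      also have "\<dots> = (\<Sum>m=1..K+degree p. (if m < K then 0 else c (m - K)) * ?L (coeff p (m - K)) (i, j))"
        by (rule shift) (simp add: K_def)
      also have "\<dots> = (\<Sum>m=1..K+degree p. (if m < K then 0 else c (m - K)) * coeff q m (i, j))"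
      proof (rule sum.cong)
        fix m assume "m \<in> {1..K + degree p}"
        then show "(if m < K then 0 else c (m - K)) * ?L (coeff p (m - K)) (i, j) =
            (if m < K then 0 else c (m - K)) * coeff q m (i, j)"
          using c2[of "m - K"] by (auto simp: K_def)
      qed simp
      finally show ?thesis .
    qed
    then show "?L X \<in> coeff_span 1 d q" by (rule coeff_spanI[OF r(1)])
    have "int r * ?Q X (i, j) = (\<Sum>m=1..2*K+degree p. (if m < 2*K then 0 else - c (m - 2*K)) * coeff q m (i, j))"
      if "i < d" "j < d" for i j
    proof -
      have "int r * ?Q X (i, j) = (\<Sum>m=0..degree p. c m * ?Q (coeff p m) (i, j))"
        using that kl r(2) by (auto simp: conj_quad_def)
      also have "\<dots> = (\<Sum>m=1..2*K+degree p. (if m < 2*K then 0 else c (m - 2*K)) * ?Q (coeff p (m - 2*K)) (i, j))"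
        by (rule shift) (simp add: K_def)
      also have "\<dots> = (\<Sum>m=1..2*K+degree p. (if m < 2*K then 0 else - c (m - 2*K)) * coeff q m (i, j))"
      proof (rule sum.cong)
        fix m assume "m \<in> {1..2*K + degree p}"
        then show "(if m < 2*K then 0 else c (m - 2*K)) * ?Q (coeff p (m - 2*K)) (i, j) =
            (if m < 2*K then 0 else - c (m - 2*K)) * coeff q m (i, j)"
          using c3[of "m - 2*K"] by auto
      qed simp
      finally show ?thesis .
    qed
    then show "?Q X \<in> coeff_span 1 d q" by (rule coeff_spanI[OF r(1)])
  qed
qed

section \<open>Generating all trace zero matrices from one nonzero matrix\<close>

definition unit_entry :: "nat \<Rightarrow> nat \<Rightarrow> entries" where
  "unit_entry i j = (\<lambda>x. if x = (i, j) then 1 else 0)"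

text \<open>A preorder for chaining matrix computations without naming the curves: curves are
  prolonged so that nothing already spanned is lost.\<close>

definition reaches :: "nat \<Rightarrow> int mat \<Rightarrow> entries \<Rightarrow> entries \<Rightarrow> bool" where
  "reaches d A X Y \<longleftrightarrow> (\<forall>p. conj_path d A p \<longrightarrow> X \<in> coeff_span 1 d p \<longrightarrow>
     (\<exists>q. conj_path d A q \<and> coeff_span 1 d p \<subseteq> coeff_span 1 d q \<and> Y \<in> coeff_span 1 d q))"

lemma reaches_refl: "reaches d A X X"
  unfolding reaches_def by blast

lemma reaches_trans: "reaches d A X Y \<Longrightarrow> reaches d A Y Z \<Longrightarrow> reaches d A X Z"
  unfolding reaches_def by (meson order_trans)

lemma reaches_conj_lin:
  assumes "A \<in> carrier_mat d d" "k < d" "l < d" "k \<noteq> l" "n \<noteq> 0" "conj_lin k l X = (\<lambda>x. n * Y x)"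
  shows "reaches d A X Y"
  unfolding reaches_def
proof (intro allI impI)
  fix p assume p: "conj_path d A p" "X \<in> coeff_span 1 d p"
  then obtain q where "conj_path d A q" "coeff_span 1 d p \<subseteq> coeff_span 1 d q" "conj_lin k l X \<in> coeff_span 1 d q"
    using conj_path_step[OF assms(1) p(1) assms(2-4)] coeff_span_1_subset by (metis subsetD)
  then show "\<exists>q. conj_path d A q \<and> coeff_span 1 d p \<subseteq> coeff_span 1 d q \<and> Y \<in> coeff_span 1 d q"
    using coeff_span_scale_cancel assms(5,6) by metis
qed

lemma reaches_conj_quad:
  assumes "A \<in> carrier_mat d d" "k < d" "l < d" "k \<noteq> l" "n \<noteq> 0" "conj_quad k l X = (\<lambda>x. n * Y x)"
  shows "reaches d A X Y"
  unfolding reaches_def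
proof (intro allI impI)
  fix p assume p: "conj_path d A p" "X \<in> coeff_span 1 d p"
  then obtain q where "conj_path d A q" "coeff_span 1 d p \<subseteq> coeff_span 1 d q" "conj_quad k l X \<in> coeff_span 1 d q"
    using conj_path_step[OF assms(1) p(1) assms(2-4)] coeff_span_1_subset by (metis subsetD)
  then show "\<exists>q. conj_path d A q \<and> coeff_span 1 d p \<subseteq> coeff_span 1 d q \<and> Y \<in> coeff_span 1 d q"
    using coeff_span_scale_cancel assms(5,6) by metis
qed

text \<open>Commutators move the row or the column index as long as the position stays off the
  diagonal. If the new row index is the old column index, the quadratic term first swaps the two
  indices; for \<open>d = 2\<close> this is the only move available.\<close>

lemma reaches_unit_entry:
  assumes A: "A \<in> carrier_mat d d" and "a < d" "b < d" "a \<noteq> b" "i < d" "j < d" "i \<noteq> j"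
  shows "reaches d A (unit_entry a b) (unit_entry i j)"
proof -
  have row: "reaches d A (unit_entry a b) (unit_entry i b)"
    if "a < d" "b < d" "a \<noteq> b" "i < d" "i \<noteq> b" for a b i
  proof (cases "i = a")
    case False
    then show ?thesis using that
      by (intro reaches_conj_lin[OF A, of i a 1]) (auto simp: conj_lin_def unit_entry_def fun_eq_iff)
  qed (simp add: reaches_refl)
  have col: "reaches d A (unit_entry a b) (unit_entry a j)"
    if "a < d" "b < d" "a \<noteq> b" "j < d" "j \<noteq> a" for a b j
  proof (cases "j = b")
    case False
    then show ?thesis using that
      by (intro reaches_conj_lin[OF A, of b j "-1"]) (auto simp: conj_lin_def unit_entry_def fun_eq_iff)
  qed (simp add: reaches_refl)
  have flip: "reaches d A (unit_entry a b) (unit_entry b a)" if "a < d" "b < d" "a \<noteq> b" for a b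
    using that by (intro reaches_conj_quad[OF A, of b a 1]) (auto simp: conj_quad_def unit_entry_def fun_eq_iff)
  show ?thesis
  proof (cases "i = b")
    case True
    then show ?thesis using flip[of a b] col[of b a j] assms by (auto intro: reaches_trans)
  next
    case False
    then show ?thesis using row[of a b i] col[of i b j] assms by (auto intro: reaches_trans)
  qed
qed

lemma reaches_diagonal:
  assumes A: "A \<in> carrier_mat d d" and "a < d" "b < d" "a \<noteq> b"
  shows "reaches d A (unit_entry a b) (\<lambda>x. unit_entry a a x - unit_entry b b x)"
  using assms by (intro reaches_conj_lin[OF A, of b a "-1"]) (auto simp: conj_lin_def unit_entry_def fun_eq_iff)

text \<open>A nonzero off-diagonal entry is isolated by the quadratic term. Otherwise
  \<open>A\<close> is diagonal with two different entries, as a scalar matrix of trace zero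
  vanishes, and a commutator isolates their difference.\<close>

lemma unit_entry_in_span_exists:
  assumes A: "A \<in> M0 d" "A \<noteq> 0\<^sub>m d d"
  obtains a b p where "a < d" "b < d" "a \<noteq> b" "conj_path d A p" "unit_entry a b \<in> coeff_span 1 d p"
proof -
  have Ac: "A \<in> carrier_mat d d" and tr: "mtrace A = 0" using A(1) by (auto simp: M0_def)
  define p where "p = [:\<lambda>x. A $$ x:]"
  have p: "conj_path d A p" unfolding p_def by (rule conj_path_exists[OF Ac])
  note A0 = conj_path_self_in_span[OF p]
  show thesis
  proof (cases "\<exists>i<d. \<exists>j<d. i \<noteq> j \<and> A $$ (j, i) \<noteq> 0")
    case True
    then obtain i j where ij: "i < d" "j < d" "i \<noteq> j" "A $$ (j, i) \<noteq> 0" by blast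
    obtain q where q: "conj_path d A q" "conj_quad i j (\<lambda>x. A $$ x) \<in> coeff_span 1 d q"
      using conj_path_step[OF Ac p ij(1-3)] A0 by metis
    have "conj_quad i j (\<lambda>x. A $$ x) = (\<lambda>x. A $$ (j, i) * unit_entry i j x)"
      by (auto simp: conj_quad_def unit_entry_def fun_eq_iff)
    then have "unit_entry i j \<in> coeff_span 1 d q"
      using q(2) ij(4) coeff_span_scale_cancel by metis
    then show thesis using that ij q(1) by blast
  next
    case False
    have "\<exists>i<d. \<exists>j<d. A $$ (i, i) \<noteq> A $$ (j, j)"
    proof (rule ccontr)
      assume *: "\<not> (\<exists>i<d. \<exists>j<d. A $$ (i, i) \<noteq> A $$ (j, j))"
      have "A $$ (i, i) = 0" if i: "i < d" for i
      proof -
        have "(\<Sum>j<d. A $$ (j, j)) = (\<Sum>j<d. A $$ (i, i))"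
          by (rule sum.cong[OF refl]) (use * i in blast)
        then show ?thesis using tr Ac i by (simp add: mtrace_def)
      qed
      then have "A $$ (i, j) = 0" if "i < d" "j < d" for i j
        using that False by (cases "i = j") blast+
      then have "A = 0\<^sub>m d d" using Ac by (intro eq_matI) auto
      then show False using A(2) by contradiction
    qed
    then obtain i j where ij: "i < d" "j < d" "A $$ (i, i) \<noteq> A $$ (j, j)" by blast
    then have "i \<noteq> j" by auto
    then obtain q where q: "conj_path d A q" "conj_lin i j (\<lambda>x. A $$ x) \<in> coeff_span 1 d q"
      using conj_path_step[OF Ac p ij(1,2)] A0 by metis
    \<comment> \<open>The commutator is compared with its expected value only inside the square,
      which is all that \<open>coeff_span\<close> sees.\<close>
    have "(\<lambda>x. (A $$ (j, j) - A $$ (i, i)) * unit_entry i j x) \<in> coeff_span 1 d q"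
      by (rule coeff_span_cong[OF q(2)])
        (use False ij in \<open>auto simp: conj_lin_def unit_entry_def\<close>)
    then have "unit_entry i j \<in> coeff_span 1 d q"
      using ij(3) coeff_span_scale_cancel[of "A $$ (j, j) - A $$ (i, i)"] by simp
    then show thesis using that ij \<open>i \<noteq> j\<close> q(1) by blast
  qed
qed

lemma reaches_finite:
  assumes "finite S" "\<And>Y. Y \<in> S \<Longrightarrow> reaches d A X Y" "conj_path d A p" "X \<in> coeff_span 1 d p"
  shows "\<exists>q. conj_path d A q \<and> X \<in> coeff_span 1 d q \<and> S \<subseteq> coeff_span 1 d q"
  using assms(1,2)
proof (induction S)
  case empty
  then show ?case using assms(3,4) by blast
next
  case (insert Y S)
  then obtain q where q: "conj_path d A q" "X \<in> coeff_span 1 d q" "S \<subseteq> coeff_span 1 d q" by auto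
  moreover have "reaches d A X Y" using insert.prems by simp
  ultimately obtain q' where "conj_path d A q'" "coeff_span 1 d q \<subseteq> coeff_span 1 d q'" "Y \<in> coeff_span 1 d q'"
    unfolding reaches_def by blast
  then show ?case using q by (intro exI[of _ q']) auto
qed

definition coords :: "nat \<Rightarrow> (nat \<times> nat) set" where
  "coords d = {..<d} \<times> {..<d} - {(d - 1, d - 1)}"

lemma spanning_conj_path:
  assumes A: "A \<in> M0 d" "A \<noteq> 0\<^sub>m d d"
  obtains p where "conj_path d A p"
    "\<forall>x\<in>coords d. \<exists>r>0::nat. \<exists>c::nat \<Rightarrow> int. \<forall>y\<in>coords d.
       int r * (if y = x then 1 else 0) = (\<Sum>m=1..degree p. c m * coeff p m y)"
proof -
  have Ac: "A \<in> carrier_mat d d" using A(1) by (auto simp: M0_def)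
  obtain a b p where ab: "a < d" "b < d" "a \<noteq> b" "conj_path d A p" "unit_entry a b \<in> coeff_span 1 d p"
    using unit_entry_in_span_exists[OF A] by blast
  \<comment> \<open>A basis of the trace zero matrices: subtracting the last diagonal unit corrects
    the trace and is invisible on \<open>coords d\<close>, where \<open>Z x\<close> is the indicator
    of \<open>x\<close>.\<close>
  define Z where "Z = (\<lambda>(i, j). if i = j then (\<lambda>x. unit_entry i i x - unit_entry (d - 1) (d - 1) x) else unit_entry i j)"
  have "reaches d A (unit_entry a b) (Z x)" if "x \<in> coords d" for x
  proof -
    from that obtain i j where x: "x = (i, j)" "i < d" "j < d" "(i, j) \<noteq> (d - 1, d - 1)"
      unfolding coords_def by (cases x) auto
    show ?thesis
    proof (cases "i = j")
      case True
      then have "i \<noteq> d - 1" "d - 1 < d" using x by auto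
      then show ?thesis
        using reaches_trans[OF reaches_unit_entry[OF Ac ab(1-3), of i "d - 1"] reaches_diagonal[OF Ac, of i "d - 1"]] x(1,2) True
        unfolding Z_def by simp
    next
      case False
      then show ?thesis using reaches_unit_entry[OF Ac ab(1-3)] x by (simp add: Z_def)
    qed
  qed
  then obtain q where q: "conj_path d A q" "Z ` coords d \<subseteq> coeff_span 1 d q"
    using reaches_finite[of "Z ` coords d" d A "unit_entry a b" p] ab(4,5) unfolding coords_def by auto
  show thesis
  proof (rule that[OF q(1)], rule ballI)
    fix x assume x: "x \<in> coords d"
    then have "Z x \<in> coeff_span 1 d q" using q(2) by auto
    from coeff_span_degree[OF this] obtain r :: nat and c :: "nat \<Rightarrow> int" where r: "r > 0"
      "\<And>i j. i < d \<Longrightarrow> j < d \<Longrightarrow> int r * Z x (i, j) = (\<Sum>m=1..degree q. c m * coeff q m (i, j))"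
      by blast
    have "Z x y = (if y = x then 1 else 0)" if "y \<in> coords d" for y
      using that x by (auto simp: Z_def coords_def unit_entry_def split: prod.splits)
    then have "int r * (if y = x then 1 else 0) = (\<Sum>m=1..degree q. c m * coeff q m y)" if "y \<in> coords d" for y
      using r(2)[of "fst y" "snd y"] that by (auto simp: coords_def)
    then show "\<exists>r>0::nat. \<exists>c::nat \<Rightarrow> int. \<forall>y\<in>coords d.
       int r * (if y = x then 1 else 0) = (\<Sum>m=1..degree q. c m * coeff q m y)" using r(1) by blast
  qed
qed

section \<open>Coordinates of trace zero matrices\<close>

text \<open>Trades the limsup for a threshold exceeded infinitely often, the form used by the
  argument with means.\<close>

lemma upper_density_pos_iff:
  "upper_density d E > 0 \<longleftrightarrow>
   (\<exists>c>0. \<exists>\<^sub>F n in sequentially. real (card (E \<inter> Fbox d n)) / real (card (Fbox d n)) > c)"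
proof
  assume "upper_density d E > 0"
  then obtain c where c: "0 < ereal c" "ereal c < upper_density d E"
    using ereal_dense2 by blast
  have "\<exists>\<^sub>F n in sequentially. real (card (E \<inter> Fbox d n)) / real (card (Fbox d n)) > c"
  proof (rule ccontr)
    assume "\<not> ?thesis"
    then have "\<forall>\<^sub>F n in sequentially. ereal (real (card (E \<inter> Fbox d n)) / real (card (Fbox d n))) \<le> ereal c"
      by (simp add: not_frequently not_less)
    then have "upper_density d E \<le> ereal c"
      unfolding upper_density_def by (rule Limsup_bounded)
    then show False using c(2) by simp
  qed
  then show "\<exists>c>0. \<exists>\<^sub>F n in sequentially. real (card (E \<inter> Fbox d n)) / real (card (Fbox d n)) > c"
    using c(1) by auto
next
  assume "\<exists>c>0. \<exists>\<^sub>F n in sequentially. real (card (E \<inter> Fbox d n)) / real (card (Fbox d n)) > c"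
  then obtain c where c: "c > 0" "\<exists>\<^sub>F n in sequentially. real (card (E \<inter> Fbox d n)) / real (card (Fbox d n)) > c"
    by blast
  have "\<not> upper_density d E < ereal c"
  proof
    assume "upper_density d E < ereal c"
    then have "\<forall>\<^sub>F n in sequentially. ereal (real (card (E \<inter> Fbox d n)) / real (card (Fbox d n))) < ereal c"
      unfolding upper_density_def by (rule Limsup_lessD)
    then have "\<forall>\<^sub>F n in sequentially. \<not> real (card (E \<inter> Fbox d n)) / real (card (Fbox d n)) > c"
      by eventually_elim simp
    then show False using c(2) by (simp add: frequently_def)
  qed
  then show "upper_density d E > 0" using c(1)
    by (meson ereal_less(2) less_le_trans not_less)
qed

section \<open>Trace and divisibility under conjugation\<close>

lemma mtrace_mult_commute:
  assumes "A \<in> carrier_mat d d" "B \<in> carrier_mat d d"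
  shows "mtrace (A * B) = mtrace (B * A)"
proof -
  have "mtrace (A * B) = (\<Sum>i<d. \<Sum>j<d. A $$ (i, j) * B $$ (j, i))"
    using assms by (simp add: mtrace_def scalar_prod_def atLeast0LessThan)
  also have "\<dots> = (\<Sum>j<d. \<Sum>i<d. A $$ (i, j) * B $$ (j, i))"
    by (rule sum.swap)
  also have "\<dots> = mtrace (B * A)"
    using assms by (simp add: mtrace_def scalar_prod_def atLeast0LessThan mult.commute)
  finally show ?thesis .
qed

lemma conj_orbit_M0:
  assumes "A \<in> M0 d" "X \<in> conj_orbit d A"
  shows "X \<in> M0 d"
proof -
  obtain g h where gh: "X = g * A * h" "g \<in> carrier_mat d d" "h \<in> carrier_mat d d" "h * g = 1\<^sub>m d"
    using assms(2) unfolding conj_orbit_def SL_def by auto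
  have A: "A \<in> carrier_mat d d" "mtrace A = 0" using assms(1) by (auto simp: M0_def)
  have "mtrace X = mtrace (h * (g * A))"
    unfolding gh(1) using gh A by (intro mtrace_mult_commute) auto
  also have "h * (g * A) = A"
    using assoc_mult_mat[OF gh(3,2) A(1)] gh(4) A(1) by simp
  finally show ?thesis using gh A by (auto simp: M0_def)
qed

lemma dvd_mult_mat:
  assumes "A \<in> carrier_mat d d" "B \<in> carrier_mat d d"
    and "(\<forall>i<d. \<forall>j<d. (k::int) dvd A $$ (i, j)) \<or> (\<forall>i<d. \<forall>j<d. k dvd B $$ (i, j))"
    and "i < d" "j < d"
  shows "k dvd (A * B) $$ (i, j)"
  using assms by (auto simp: scalar_prod_def intro!: dvd_sum)

lemma conj_orbit_dvd:
  assumes "A \<in> kM0 k d" "X \<in> conj_orbit d A" "i < d" "j < d"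
  shows "k dvd X $$ (i, j)"
proof -
  obtain g h where gh: "X = g * A * h" "g \<in> carrier_mat d d" "h \<in> carrier_mat d d"
    using assms(2) unfolding conj_orbit_def SL_def by auto
  have A: "A \<in> carrier_mat d d" "\<forall>i<d. \<forall>j<d. k dvd A $$ (i, j)"
    using assms(1) by (auto simp: kM0_def M0_def)
  have "\<forall>i<d. \<forall>j<d. k dvd (g * A) $$ (i, j)"
    using dvd_mult_mat[OF gh(2) A(1)] A(2) by blast
  then show ?thesis
    unfolding gh(1) using dvd_mult_mat[of "g * A" d h k i j] gh A(1) assms(3,4) by auto
qed

section \<open>Boxes in coordinate space and their correspondence with \<open>Fbox\<close>\<close>

lemma finite_coords: "finite (coords d)"
  by (simp add: coords_def)

definition coord_proj :: "nat \<Rightarrow> entries \<Rightarrow> entries" where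
  "coord_proj d x = (\<lambda>q. if q \<in> coords d then x q else 0)"

definition coord_box :: "nat \<Rightarrow> nat \<Rightarrow> entries set" where
  "coord_box d n = {x. (\<forall>q\<in>coords d. \<bar>x q\<bar> \<le> int n) \<and> (\<forall>q. q \<notin> coords d \<longrightarrow> x q = 0)}"

definition mat_of_coords :: "nat \<Rightarrow> entries \<Rightarrow> int mat" where
  "mat_of_coords d x = mat d d (\<lambda>(i, j). if (i, j) = (d - 1, d - 1) then - (\<Sum>l<d - 1. x (l, l)) else x (i, j))"

lemma mat_of_coords_M0:
  assumes "d \<ge> 1"
  shows "mat_of_coords d x \<in> M0 d"
proof -
  have d: "{..<d} = insert (d - 1) {..<d - 1}" using assms by auto
  have "mtrace (mat_of_coords d x) = (\<Sum>i<d. if i = d - 1 then - (\<Sum>l<d - 1. x (l, l)) else x (i, i))"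
    by (auto simp: mtrace_def mat_of_coords_def intro!: sum.cong)
  also have "\<dots> = - (\<Sum>l<d - 1. x (l, l)) + (\<Sum>i<d - 1. x (i, i))"
    unfolding d by (subst sum.insert) (auto intro!: sum.cong)
  also have "\<dots> = 0" by simp
  finally show ?thesis by (simp add: M0_def mat_of_coords_def)
qed

lemma mat_of_coords_eqI:
  assumes "d \<ge> 1" "X \<in> M0 d" "\<And>i j. (i, j) \<in> coords d \<Longrightarrow> x (i, j) = X $$ (i, j)"
  shows "mat_of_coords d x = X"
proof -
  have X: "X \<in> carrier_mat d d" "(\<Sum>i<d. X $$ (i, i)) = 0"
    using assms(2) by (auto simp: M0_def mtrace_def)
  have d: "{..<d} = insert (d - 1) {..<d - 1}" using assms(1) by auto
  have "X $$ (d - 1, d - 1) = - (\<Sum>l<d - 1. X $$ (l, l))"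
    using X(2) unfolding d by simp
  also have "(\<Sum>l<d - 1. X $$ (l, l)) = (\<Sum>l<d - 1. x (l, l))"
    by (intro sum.cong refl assms(3)[symmetric]) (auto simp: coords_def)
  finally have "X $$ (d - 1, d - 1) = - (\<Sum>l<d - 1. x (l, l))" .
  then show ?thesis
    using X(1) assms(3) by (intro eq_matI) (auto simp: mat_of_coords_def coords_def)
qed

lemma mat_of_coords_add: "mat_of_coords d (x + y) = mat_of_coords d x + mat_of_coords d y"
  by (intro eq_matI) (auto simp: mat_of_coords_def sum.distrib)

lemma bij_mat_of_coords:
  assumes "d \<ge> 1"
  shows "bij_betw (mat_of_coords d) (coord_box d n) (Fbox d n)"
proof (rule bij_betw_byWitness[where f'="\<lambda>X. coord_proj d (\<lambda>q. X $$ q)"])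
  show "\<forall>x\<in>coord_box d n. coord_proj d (\<lambda>q. mat_of_coords d x $$ q) = x"
    by (auto simp: coord_proj_def coord_box_def mat_of_coords_def fun_eq_iff coords_def)
  show "\<forall>X\<in>Fbox d n. mat_of_coords d (coord_proj d (\<lambda>q. X $$ q)) = X"
    using assms by (intro ballI mat_of_coords_eqI) (auto simp: Fbox_def coord_proj_def)
  show "mat_of_coords d ` coord_box d n \<subseteq> Fbox d n"
    using mat_of_coords_M0[OF assms] by (auto simp: Fbox_def coord_box_def) (auto simp: mat_of_coords_def coords_def)
  show "(\<lambda>X. coord_proj d (\<lambda>q. X $$ q)) ` Fbox d n \<subseteq> coord_box d n"
  proof
    fix y assume "y \<in> (\<lambda>X. coord_proj d (\<lambda>q. X $$ q)) ` Fbox d n"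
    then obtain X where X: "X \<in> Fbox d n" "y = coord_proj d (\<lambda>q. X $$ q)" by blast
    have "\<bar>X $$ q\<bar> \<le> int n" if "q \<in> coords d" for q
      using that X(1) by (cases q) (auto simp: Fbox_def coords_def)
    then show "y \<in> coord_box d n" by (simp add: X(2) coord_box_def coord_proj_def)
  qed
qed

lemma coord_box_PiE:
  "bij_betw (\<lambda>x. restrict x (coords d)) (coord_box d n) (PiE (coords d) (\<lambda>_. {- int n..int n}))"
proof (rule bij_betw_byWitness[where f'="coord_proj d"])
  show "\<forall>x\<in>coord_box d n. coord_proj d (restrict x (coords d)) = x"
    by (auto simp: coord_box_def coord_proj_def fun_eq_iff)
  show "\<forall>x\<in>PiE (coords d) (\<lambda>_. {- int n..int n}). restrict (coord_proj d x) (coords d) = x"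
    by (auto simp: coord_proj_def fun_eq_iff PiE_def extensional_def restrict_def)
  show "(\<lambda>x. restrict x (coords d)) ` coord_box d n \<subseteq> PiE (coords d) (\<lambda>_. {- int n..int n})"
    by (auto simp: coord_box_def abs_le_iff)
  show "coord_proj d ` PiE (coords d) (\<lambda>_. {- int n..int n}) \<subseteq> coord_box d n"
    by (auto simp: coord_box_def coord_proj_def PiE_iff abs_le_iff) (smt (verit))
qed

lemma card_coord_box: "card (coord_box d n) = (2 * n + 1) ^ card (coords d)"
proof -
  have "card {- int n..int n} = 2 * n + 1" by simp
  then show ?thesis
    using bij_betw_same_card[OF coord_box_PiE] by (simp add: card_PiE finite_coords)
qed

lemma finite_coord_box: "finite (coord_box d n)"
  using card_coord_box[of d n] by (intro card_ge_0_finite) simp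

lemma coord_box_nonempty: "coord_box d n \<noteq> {}"
  using card_coord_box[of d n] by auto

lemma coord_proj_add: "coord_proj d (x + y) = coord_proj d x + coord_proj d y"
  by (auto simp: coord_proj_def)

text \<open>If \<open>K\<close> bounds the entries of \<open>g\<close> on \<open>coords d\<close>,
  the box of size \<open>n - K\<close> lies in both the box of size \<open>n\<close> and its
  translate. What sticks out is at most the difference of the two box cardinalities, whose share
  tends to zero.\<close>

lemma coord_box_folner:
  "(\<lambda>n. card ((\<lambda>x. x + coord_proj d g) ` coord_box d n - coord_box d n) / card (coord_box d n)) \<longlonglongrightarrow> 0"
proof -
  define K where "K = (\<Sum>q\<in>coords d. nat \<bar>g q\<bar>)"
  define N where "N = card (coords d)"
  have K: "\<bar>g q\<bar> \<le> int K" if "q \<in> coords d" for q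
  proof -
    have "nat \<bar>g q\<bar> \<le> K"
      unfolding K_def by (rule member_le_sum[OF that]) (simp_all add: finite_coords)
    then show ?thesis by simp
  qed
  define b where "b = (\<lambda>n::nat. 1 - (1 - 2 * real K / (2 * real n + 1)) ^ N)"
  have "card ((\<lambda>x. x + coord_proj d g) ` coord_box d n - coord_box d n) / card (coord_box d n) \<le> b n"
    if n: "n \<ge> K" for n
  proof -
    let ?S = "(\<lambda>x. x + coord_proj d g) ` coord_box d n"
    have "coord_box d (n - K) \<subseteq> ?S"
    proof
      fix y assume y: "y \<in> coord_box d (n - K)"
      have "y - coord_proj d g \<in> coord_box d n"
      proof -
        have "\<bar>y q - g q\<bar> \<le> int n" if "q \<in> coords d" for q
          using y K[OF that] that n unfolding coord_box_def by fastforce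
        then show ?thesis using y by (auto simp: coord_box_def coord_proj_def)
      qed
      then show "y \<in> ?S" by (intro image_eqI[of _ _ "y - coord_proj d g"]) auto
    qed
    moreover have sub: "coord_box d (n - K) \<subseteq> coord_box d n"
      unfolding coord_box_def by force
    ultimately have "?S - coord_box d n \<subseteq> ?S - coord_box d (n - K)" "coord_box d (n - K) \<subseteq> ?S" by auto
    then have "card (?S - coord_box d n) \<le> card ?S - card (coord_box d (n - K))"
      using card_mono[of "?S - coord_box d (n - K)" "?S - coord_box d n"] finite_coord_box
      by (simp add: card_Diff_subset)
    moreover have "card ?S = card (coord_box d n)"
      by (rule card_image) (simp add: inj_on_def)
    moreover have "card (coord_box d (n - K)) \<le> card (coord_box d n)"
      using sub finite_coord_box by (rule card_mono[rotated])
    ultimately have "real (card (?S - coord_box d n)) \<le> real (card (coord_box d n)) - real (card (coord_box d (n - K)))"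
      by linarith
    then have "card (?S - coord_box d n) / card (coord_box d n)
        \<le> 1 - real (card (coord_box d (n - K))) / real (card (coord_box d n))"
      by (simp add: card_coord_box field_simps)
    also have "real (card (coord_box d (n - K))) / real (card (coord_box d n)) = (1 - 2 * real K / (2 * real n + 1)) ^ N"
      using n by (simp add: card_coord_box N_def of_nat_diff flip: power_divide) (simp add: field_simps)
    finally show ?thesis unfolding b_def .
  qed
  then have "\<forall>\<^sub>F n in sequentially.
      card ((\<lambda>x. x + coord_proj d g) ` coord_box d n - coord_box d n) / card (coord_box d n) \<le> b n"
    unfolding eventually_sequentially by blast
  moreover have "b \<longlonglongrightarrow> 0"
  proof -
    have "(\<lambda>n. 2 * real K / (2 * real n + 1)) \<longlonglongrightarrow> 0" by real_asymp
    then have "b \<longlonglongrightarrow> 1 - (1 - 0) ^ N"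
      unfolding b_def by (intro tendsto_intros)
    then show ?thesis by simp
  qed
  ultimately show ?thesis
    by (rule tendsto_sandwich[OF always_eventually[OF allI] _ tendsto_const[of 0], rotated]) simp
qed

text \<open>The product \<open>l\<close> of the denominators of the single coordinates serves for
  all integer combinations of them at once.\<close>

lemma coord_span:
  assumes "\<forall>x\<in>coords d. \<exists>r>0::nat. \<exists>c::nat \<Rightarrow> int. \<forall>y\<in>coords d.
       int r * (if y = x then 1 else 0) = (\<Sum>m=1..degree p. c m * coeff p m y)"
  shows "\<exists>l>0. \<forall>x. \<exists>c::nat \<Rightarrow> int. coord_proj d (of_nat l * x) =
    coord_proj d (\<Sum>j=1..degree p. of_int (c j) * coeff p j)"
proof -
  have "\<forall>q\<in>coords d. \<exists>z :: nat \<times> (nat \<Rightarrow> int). fst z > 0 \<and> (\<forall>y\<in>coords d.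
      int (fst z) * (if y = q then 1 else 0) = (\<Sum>m=1..degree p. snd z m * coeff p m y))"
    using assms by simp
  from bchoice[OF this] obtain z :: "nat \<times> nat \<Rightarrow> nat \<times> (nat \<Rightarrow> int)" where
    z: "\<forall>q\<in>coords d. fst (z q) > 0 \<and> (\<forall>y\<in>coords d.
      int (fst (z q)) * (if y = q then 1 else 0) = (\<Sum>m=1..degree p. snd (z q) m * coeff p m y))" ..
  define r where "r = (\<lambda>q. fst (z q))"
  define c where "c = (\<lambda>q. snd (z q))"
  have r: "r q > 0" if "q \<in> coords d" for q
    using z that unfolding r_def by blast
  have c: "int (r q) * (if y = q then 1 else 0) = (\<Sum>m=1..degree p. c q m * coeff p m y)"
    if "q \<in> coords d" "y \<in> coords d" for q y
    using z that unfolding r_def c_def by blast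
  define l where "l = prod r (coords d)"
  have l: "l > 0" unfolding l_def using r by (intro prod_pos) auto
  have div: "int (l div r q) * int (r q) = int l" if "q \<in> coords d" for q
    using dvd_prodI[OF finite_coords that, of r] unfolding l_def by (simp flip: of_nat_mult)
  have "\<exists>c'::nat \<Rightarrow> int. coord_proj d (of_nat l * x) = coord_proj d (\<Sum>j=1..degree p. of_int (c' j) * coeff p j)" for x
  proof -
    define c' where "c' = (\<lambda>m. \<Sum>q\<in>coords d. x q * int (l div r q) * c q m)"
    have "int l * x y = (\<Sum>j=1..degree p. c' j * coeff p j y)" if y: "y \<in> coords d" for y
    proof -
      have "(\<Sum>j=1..degree p. c' j * coeff p j y)
          = (\<Sum>q\<in>coords d. x q * int (l div r q) * (\<Sum>j=1..degree p. c q j * coeff p j y))"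
        unfolding c'_def sum_distrib_right sum_distrib_left
        by (subst sum.swap) (simp add: mult.assoc)
      also have "\<dots> = (\<Sum>q\<in>coords d. x q * (int (l div r q) * int (r q)) * (if y = q then 1 else 0))"
        using c[OF _ y] by (intro sum.cong refl) (simp add: mult.assoc)
      also have "\<dots> = (\<Sum>q\<in>coords d. if y = q then x q * int l else 0)"
        using div by (intro sum.cong refl) auto
      also have "\<dots> = int l * x y"
        using y finite_coords by (simp add: mult.commute)
      finally show ?thesis ..
    qed
    then show ?thesis
      by (intro exI[of _ c']) (auto simp: coord_proj_def fun_eq_iff sum_fun_apply of_int_fun_apply)
  qed
  then show ?thesis using l by blast
qed

section \<open>Recurrence along conjugacy classes of trace zero matrices\<close>

theorem theorem1p5:
  fixes d :: nat and E :: "int mat set"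
  assumes "d \<ge> 2"
    and "E \<subseteq> M0 d"
    and "upper_density d E > 0"
  shows "\<exists>k::int. k \<ge> 1 \<and>
           (\<forall>A \<in> kM0 k d. \<exists>g \<in> SL d. \<exists>h \<in> carrier_mat d d.
              g * h = 1\<^sub>m d \<and> h * g = 1\<^sub>m d \<and>
              upper_density d (E \<inter> set_minus_mat E (g * A * h)) > 0)"
proof -
  have d: "d \<ge> 1" using assms(1) by simp
  define S where "S = {x. mat_of_coords d x \<in> E}"
  let ?\<mu> = "mat_of_coords d" and ?\<pi> = "coord_proj d" and ?M = "coord_box d"
  have card_transfer: "card (Z \<inter> Fbox d n) = card {x \<in> ?M n. ?\<mu> x \<in> Z}" for Z n
  proof -
    have "bij_betw ?\<mu> {x \<in> ?M n. ?\<mu> x \<in> Z} (Z \<inter> Fbox d n)"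
    proof (rule bij_betw_subset[OF bij_mat_of_coords[OF d]])
      show "?\<mu> ` {x \<in> ?M n. ?\<mu> x \<in> Z} = Z \<inter> Fbox d n"
        unfolding bij_betw_imp_surj_on[OF bij_mat_of_coords[OF d], symmetric] by auto
    qed auto
    then show ?thesis by (rule bij_betw_same_card[symmetric])
  qed
  have card_box: "card (Fbox d n) = card (?M n)" for n
    by (rule bij_betw_same_card[OF bij_mat_of_coords[OF d], symmetric])
  obtain c where c: "c > 0" "\<exists>\<^sub>F n in sequentially. real (card (E \<inter> Fbox d n)) / real (card (Fbox d n)) > c"
    using assms(3) upper_density_pos_iff by blast
  have "card (S \<inter> ?M n) = card (E \<inter> Fbox d n)" for n
    unfolding card_transfer S_def by (rule arg_cong[of _ _ card]) auto
  then have "\<exists>\<^sub>F n in sequentially. card (S \<inter> ?M n) / card (?M n) > c"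
    using c(2) by (simp add: card_box)
  from density_polynomial_recurrence[of ?M ?\<pi>, OF finite_coord_box coord_box_nonempty coord_proj_add
      coord_box_folner c(1) this]
  obtain k where k: "k > 0" and rec: "\<forall>p. (\<forall>t::nat. \<exists>x. ?\<pi> (poly p (of_nat t)) = ?\<pi> (of_nat k * x)) \<longrightarrow>
    (\<exists>l>0. \<forall>x. \<exists>c::nat \<Rightarrow> int. ?\<pi> (of_nat l * x) = ?\<pi> (\<Sum>j=1..degree p. of_int (c j) * coeff p j)) \<longrightarrow>
    (\<exists>t::nat. \<exists>c>0. \<exists>\<^sub>F n in sequentially.
       card {x \<in> ?M n. x \<in> S \<and> x + ?\<pi> (poly p (of_nat t)) \<in> S} / card (?M n) > c)"
    by (elim exE conjE) (rule that)
  have "\<exists>X\<in>conj_orbit d A. upper_density d (E \<inter> set_minus_mat E X) > 0" if A: "A \<in> kM0 (int k) d" for A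
  proof -
    have A0: "A \<in> M0 d" "A \<in> carrier_mat d d" using A by (auto simp: kM0_def M0_def)
    show ?thesis
    proof (cases "A = 0\<^sub>m d d")
      \<comment> \<open>A curve of conjugates of zero is constant and spans nothing; here
        \<open>A\<close> itself is the conjugate to take.\<close>
      case True
      have "x - A = x" if "x \<in> E" for x
      proof -
        have "x \<in> carrier_mat d d" using that assms(2) by (auto simp: M0_def)
        then show ?thesis unfolding True by (intro eq_matI) auto
      qed
      then have "set_minus_mat E A = E"
        using image_cong[of E E "\<lambda>x. x - A" "\<lambda>x. x"] by (simp add: set_minus_mat_def)
      then show ?thesis using assms(3) by (intro bexI[OF _ self_in_conj_orbit[OF A0(2)]]) simp
    next
      case False
      obtain p where p: "conj_path d A p"
        "\<forall>x\<in>coords d. \<exists>r>0::nat. \<exists>c::nat \<Rightarrow> int. \<forall>y\<in>coords d.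
           int r * (if y = x then 1 else 0) = (\<Sum>m=1..degree p. c m * coeff p m y)"
        using spanning_conj_path[OF A0(1) False] .
      have path: "\<exists>X\<in>conj_orbit d A. \<forall>i<d. \<forall>j<d. X $$ (i, j) = poly p (of_nat t) (i, j)" for t
        using p(1) unfolding conj_path_def by (elim conjE) (erule spec)
      \<comment> \<open>Divisibility by \<open>k\<close> survives conjugation, so every value of the
        curve is \<open>k\<close> times an integer matrix on \<open>coords d\<close>.\<close>
      have "\<forall>t::nat. \<exists>x. ?\<pi> (poly p (of_nat t)) = ?\<pi> (of_nat k * x)"
      proof
        fix t :: nat
        obtain X where X: "X \<in> conj_orbit d A" "\<forall>i<d. \<forall>j<d. X $$ (i, j) = poly p (of_nat t) (i, j)"
          using path[of t] by (rule bexE)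
        have "poly p (of_nat t) q = int k * (X $$ q div int k)" if "q \<in> coords d" for q
          using that X(2) conj_orbit_dvd[OF A X(1), of "fst q" "snd q"] by (cases q) (simp add: coords_def)
        then show "\<exists>x. ?\<pi> (poly p (of_nat t)) = ?\<pi> (of_nat k * x)"
          by (intro exI[of _ "\<lambda>q. X $$ q div int k"]) (auto simp: coord_proj_def fun_eq_iff)
      qed
      from rec[THEN spec[where x=p], THEN mp, OF this, THEN mp, OF coord_span[OF p(2)]]
      obtain t c where tc: "c > 0" "\<exists>\<^sub>F n in sequentially.
          card {x \<in> ?M n. x \<in> S \<and> x + ?\<pi> (poly p (of_nat t)) \<in> S} / card (?M n) > c"
        by blast
      obtain X where X: "X \<in> conj_orbit d A" "\<forall>i<d. \<forall>j<d. X $$ (i, j) = poly p (of_nat t) (i, j)"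
        using path[of t] by (rule bexE)
      have XM: "X \<in> M0 d" by (rule conj_orbit_M0[OF A0(1) X(1)])
      have \<mu>X: "?\<mu> (?\<pi> (poly p (of_nat t))) = X"
        by (rule mat_of_coords_eqI[OF d XM]) (use X(2) in \<open>simp add: coord_proj_def coords_def\<close>)
      have minus_iff: "y \<in> set_minus_mat E X \<longleftrightarrow> y + X \<in> E" if y: "y \<in> M0 d" for y
      proof
        assume "y \<in> set_minus_mat E X"
        then obtain z where z: "z \<in> E" "y = z - X" by (auto simp: set_minus_mat_def)
        have "y + X = z"
          unfolding z(2) using z(1) assms(2) XM by (intro eq_matI) (auto simp: M0_def)
        then show "y + X \<in> E" using z(1) by simp
      next
        assume "y + X \<in> E"
        moreover have "y = (y + X) - X"
          using y XM by (intro eq_matI) (auto simp: M0_def)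
        ultimately show "y \<in> set_minus_mat E X" unfolding set_minus_mat_def by blast
      qed
      have "x + ?\<pi> (poly p (of_nat t)) \<in> S \<longleftrightarrow> ?\<mu> x \<in> set_minus_mat E X" for x
        using minus_iff[OF mat_of_coords_M0[OF d]] by (simp add: S_def mat_of_coords_add \<mu>X)
      then have "{x \<in> ?M n. x \<in> S \<and> x + ?\<pi> (poly p (of_nat t)) \<in> S} =
          {x \<in> ?M n. ?\<mu> x \<in> E \<inter> set_minus_mat E X}" for n
        by (auto simp: S_def)
      then have "\<exists>\<^sub>F n in sequentially. real (card ((E \<inter> set_minus_mat E X) \<inter> Fbox d n)) / real (card (Fbox d n)) > c"
        using tc(2) by (simp only: card_transfer card_box)
      then show ?thesis using X(1) tc(1) upper_density_pos_iff by blast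
    qed
  qed
  note orbit = this
  show ?thesis
  proof (intro exI[of _ "int k"] conjI ballI)
    show "int k \<ge> 1" using k by simp
    fix A assume "A \<in> kM0 (int k) d"
    from orbit[OF this] show "\<exists>g \<in> SL d. \<exists>h \<in> carrier_mat d d. g * h = 1\<^sub>m d \<and> h * g = 1\<^sub>m d \<and>
      upper_density d (E \<inter> set_minus_mat E (g * A * h)) > 0"
      unfolding conj_orbit_def by blast
  qed
qed

end
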